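(* Let $Y\in\mathbb{C}^{(n\times n)\cdot d}$, let $(A,b,c)_Y$ be a realization about $Y$ on the Hilbert space $\mathcal{H}$ with quantized transfer function $f$, let $\mathscr{M}_{A,b,c}=\mathscr{C}_{A,c}\ominus(\mathscr{C}_{A,c}\cap\mathscr{O}_{A^\dagger,b}^\perp)$ be its minimal subspace and $Q_0$ the orthogonal projection of $\mathcal{H}$ onto $\mathscr{M}_{A,b,c}$. Define $A^{(0)}_j(G)=Q_0A_j(G)|_{\mathscr{M}_{A,b,c}}$ for $G\in\mathbb{C}^{n\times n}$, $1\le j\le d$, $b_0=Q_0b$ and $c_0=Q_0c$. Then $(A^{(0)},b_0,c_0)_Y$ is a minimal realization about $Y$, it is analytically equivalent at $Y$ to $(A,b,c)_Y$, and the two realizations define the same quantized transfer function $f$ on $\mathscr{D}^{\leadsto Y}(A)\cap\mathscr{D}^{\leadsto Y}(A^{(0)})$.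
   Context: Fix $d\in\mathbb{N}$. $\mathbb{C}^{(k\times k)\cdot d}$ denotes column $d$-tuples of complex $k\times k$ matrices with $\|X\|_{\mathrm{col}}$ the operator norm of the stacked $kd\times k$ matrix; the uniform topology is generated by the sets $\bigsqcup_m\{X\in\mathbb{C}^{(mk\times mk)\cdot d}:\|X-I_m\otimes Z\|_{\mathrm{col}}<r\}$. A realization about $Y\in\mathbb{C}^{(n\times n)\cdot d}$, $(A,b,c)_Y$, consists of a Hilbert space $\mathcal{H}$, linear maps $A_1,\dots,A_d:\mathbb{C}^{n\times n}\to\mathscr{B}(\mathcal{H})$ and $b,c\in\mathscr{B}(\mathbb{C}^n,\mathcal{H})$. For $X\in\mathbb{C}^{(mn\times mn)\cdot d}$ (viewed as $m\times m$ block matrices with $n\times n$ blocks, $\mathrm{id}_m\otimes A_j$ acting blockwise on $\mathbb{C}^m\otimes\mathcal{H}$), $L_A(X)=I_m\otimes I_{\mathcal{H}}-\sum_j(\mathrm{id}_m\otimes A_j)(X_j)$; $\mathscr{D}^Y_m(A)=\{X\in\mathbb{C}^{(mn\times mn)\cdot d}:L_A(X-I_m\otimes Y)\text{ invertible}\}$, $\mathscr{D}^Y(A)=\bigsqcup_m\mathscr{D}^Y_m(A)$, and $\mathscr{D}^{\leadsto Y}(A)=\bigsqcup_m\mathscr{D}^{\leadsto Y}_m(A)$ where $\mathscr{D}^{\leadsto Y}_m(A)$ is the path-connected component of $\mathscr{D}^Y_m(A)$ containing $I_m\otimes Y$. The quantized transfer function is $f(X)=(I_m\otimes b^* )L_A(X-I_m\otimes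 Y)^{-1}(I_m\otimes c)$ on $\mathscr{D}^Y_m(A)$. Two realizations about $Y$ are analytically equivalent at $Y$ if their quantized transfer functions agree on a uniformly open neighbourhood of $Y$. For a word $\omega=i_1\cdots i_\ell\in\mathbb{F}^+_d$, $A^\omega(G_1,\dots,G_\ell)=A_{i_1}(G_1)\cdots A_{i_\ell}(G_\ell)$ and $A^{\omega;\dagger}(G_1,\dots,G_\ell)=A_{i_\ell}(G_\ell^* )^*\cdots A_{i_1}(G_1^* )^*$. The controllable subspace $\mathscr{C}_{A,c}$ is the closed linear span of all $A^\omega(\vec G)c(v)$ and the observable subspace $\mathscr{O}_{A^\dagger,b}$ the closed linear span of all $A^{\omega;\dagger}(\vec G)b(u)$ ($\omega\in\mathbb{F}^+_d$, $G_i\in\mathbb{C}^{n\times n}$, $u,v\in\mathbb{C}^n$). A realization is minimal if both subspaces equal the whole Hilbert space. *)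

theory Defs
  imports "HOL-Analysis.Analysis" "Jordan_Normal_Form.Matrix"
begin

class complex_vector = real_vector +
  fixes scaleC :: "complex \<Rightarrow> 'a \<Rightarrow> 'a" (infixr "*\<^sub>C" 75)
  assumes scaleC_add_right: "scaleC a (x + y) = scaleC a x + scaleC a y"
    and scaleC_add_left: "scaleC (a + b) x = scaleC a x + scaleC b x"
    and scaleC_scaleC: "scaleC a (scaleC b x) = scaleC (a * b) x"
    and scaleC_one: "scaleC 1 x = x"
    and scaleR_scaleC: "scaleR r x = scaleC (complex_of_real r) x"

class complex_inner = complex_vector + real_normed_vector +
  fixes cinner :: "'a \<Rightarrow> 'a \<Rightarrow> complex"
  assumes cinner_commute: "cinner x y = cnj (cinner y x)"
    and cinner_add_right: "cinner x (y + z) = cinner x y + cinner x z"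
    and cinner_scaleC_right: "cinner x (scaleC r y) = r * cinner x y"
    and cinner_ge_zero: "0 \<le> Re (cinner x x)"
    and cinner_eq_zero_iff: "cinner x x = 0 \<longleftrightarrow> x = 0"
    and norm_eq_sqrt_cinner: "norm x = sqrt (Re (cinner x x))"

class chilbert_space = complex_inner + complete_space

definition csubspace :: "'a::complex_vector set \<Rightarrow> bool" where
  "csubspace S \<longleftrightarrow> 0 \<in> S \<and> (\<forall>x\<in>S. \<forall>y\<in>S. x + y \<in> S) \<and> (\<forall>a. \<forall>x\<in>S. a *\<^sub>C x \<in> S)"

definition closed_csubspace :: "'a::chilbert_space set \<Rightarrow> bool" where
  "closed_csubspace S \<longleftrightarrow> csubspace S \<and> closed S"

definition cspan :: "'a::complex_vector set \<Rightarrow> 'a set" where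
  "cspan W = {x. \<exists>F a. finite F \<and> F \<subseteq> W \<and> x = (\<Sum>v\<in>F. a v *\<^sub>C v)}"

definition ccspan :: "'a::chilbert_space set \<Rightarrow> 'a set" where
  "ccspan W = closure (cspan W)"

definition orth_diff :: "'a::chilbert_space set \<Rightarrow> 'a set \<Rightarrow> 'a set" where
  "orth_diff V W = {x \<in> V. \<forall>w\<in>W. cinner w x = 0}"

definition proj :: "'a::chilbert_space set \<Rightarrow> 'a \<Rightarrow> 'a" where
  "proj M x = (THE y. y \<in> M \<and> (\<forall>z\<in>M. cinner z (x - y) = 0))"

text \<open>bounded linear operator on the Hilbert space S (only its values on S matter)\<close>
definition bop :: "'a::chilbert_space set \<Rightarrow> ('a \<Rightarrow> 'a) \<Rightarrow> bool" where
  "bop S T \<longleftrightarrow> T ` S \<subseteq> S \<and> (\<forall>x\<in>S. \<forall>y\<in>S. T (x + y) = T x + T y)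
     \<and> (\<forall>a. \<forall>x\<in>S. T (a *\<^sub>C x) = a *\<^sub>C T x) \<and> (\<exists>K. \<forall>x\<in>S. norm (T x) \<le> K * norm x)"

definition adj :: "'a::chilbert_space set \<Rightarrow> ('a \<Rightarrow> 'a) \<Rightarrow> 'a \<Rightarrow> 'a" where
  "adj S T y = (THE z. z \<in> S \<and> (\<forall>x\<in>S. cinner (T x) y = cinner x z))"

definition cadj :: "complex mat \<Rightarrow> complex mat" where
  "cadj G = mat (dim_col G) (dim_row G) (\<lambda>(i, k). cnj (G $$ (k, i)))"

definition ncpt :: "nat \<Rightarrow> nat \<Rightarrow> complex mat list \<Rightarrow> bool" where
  "ncpt d k X \<longleftrightarrow> length X = d \<and> (\<forall>j<d. X ! j \<in> carrier_mat k k)"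

text \<open>\<open>I_m \<otimes> Z\<close> for a k x k matrix Z\<close>
definition ampl :: "nat \<Rightarrow> nat \<Rightarrow> complex mat \<Rightarrow> complex mat" where
  "ampl m k Z = mat (m * k) (m * k)
     (\<lambda>(i, l). if i div k = l div k then Z $$ (i mod k, l mod k) else 0)"

definition amplt :: "nat \<Rightarrow> nat \<Rightarrow> complex mat list \<Rightarrow> complex mat list" where
  "amplt m k Z = map (ampl m k) Z"

definition vnorm :: "complex vec \<Rightarrow> real" where
  "vnorm v = sqrt (\<Sum>i<dim_vec v. (cmod (v $ i))\<^sup>2)"

text \<open>\<open>\<parallel>X\<parallel>_col\<close>: operator norm of the stacked (kd x k) matrix\<close>
definition colnorm :: "nat \<Rightarrow> complex mat list \<Rightarrow> real" where
  "colnorm k X = Sup {sqrt (\<Sum>j<length X. (vnorm (X ! j *\<^sub>v v))\<^sup>2) | v. v \<in> carrier_vec k \<and> vnorm v \<le> 1}"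

definition uball :: "nat \<Rightarrow> nat \<Rightarrow> complex mat list \<Rightarrow> real \<Rightarrow> complex mat list set" where
  "uball d k Z r = {X. \<exists>m\<ge>1. ncpt d (m * k) X \<and>
       colnorm (m * k) (map2 (-) X (amplt m k Z)) < r}"

definition uniformly_open :: "nat \<Rightarrow> complex mat list set \<Rightarrow> bool" where
  "uniformly_open d U \<longleftrightarrow>
     generate_topology {uball d k Z r | k Z r. ncpt d k Z \<and> r > 0} U"

definition blk :: "nat \<Rightarrow> complex mat \<Rightarrow> nat \<Rightarrow> nat \<Rightarrow> complex mat" where
  "blk n X p q = mat n n (\<lambda>(i, k). X $$ (p * n + i, q * n + k))"

text \<open>\<open>\<complex>^m \<otimes> S\<close>, as S-valued functions supported on {0..<m}\<close>
definition tens :: "nat \<Rightarrow> 'a::chilbert_space set \<Rightarrow> (nat \<Rightarrow> 'a) set" where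
  "tens m S = {v. (\<forall>p<m. v p \<in> S) \<and> (\<forall>p\<ge>m. v p = 0)}"

definition tnorm :: "nat \<Rightarrow> (nat \<Rightarrow> 'a::chilbert_space) \<Rightarrow> real" where
  "tnorm m v = sqrt (\<Sum>p<m. (norm (v p))\<^sup>2)"

text \<open>\<open>L_A(X)\<close> acting on \<open>\<complex>^m \<otimes> S\<close>, X a d-tuple of mn x mn matrices\<close>
definition LA :: "nat \<Rightarrow> nat \<Rightarrow> (nat \<Rightarrow> complex mat \<Rightarrow> 'a \<Rightarrow> 'a) \<Rightarrow> nat \<Rightarrow> complex mat list
    \<Rightarrow> (nat \<Rightarrow> 'a::chilbert_space) \<Rightarrow> nat \<Rightarrow> 'a" where
  "LA n d A m X v = (\<lambda>p. if p < m then
       v p - (\<Sum>j<d. \<Sum>q<m. A j (blk n (X ! j) p q) (v q)) else 0)"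

definition inv_op :: "nat \<Rightarrow> 'a::chilbert_space set \<Rightarrow> ((nat \<Rightarrow> 'a) \<Rightarrow> nat \<Rightarrow> 'a) \<Rightarrow> bool" where
  "inv_op m S L \<longleftrightarrow> (\<exists>R. (\<forall>v\<in>tens m S. R v \<in> tens m S \<and> R (L v) = v \<and> L (R v) = v)
       \<and> (\<exists>K. \<forall>v\<in>tens m S. tnorm m (R v) \<le> K * tnorm m v))"

definition Dm :: "'a::chilbert_space set \<Rightarrow> nat \<Rightarrow> nat \<Rightarrow> complex mat list
    \<Rightarrow> (nat \<Rightarrow> complex mat \<Rightarrow> 'a \<Rightarrow> 'a) \<Rightarrow> nat \<Rightarrow> complex mat list set" where
  "Dm S n d Y A m = {X. ncpt d (m * n) X \<and>
      inv_op m S (LA n d A m (map2 (-) X (amplt m n Y)))}"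

definition DY :: "'a::chilbert_space set \<Rightarrow> nat \<Rightarrow> nat \<Rightarrow> complex mat list
    \<Rightarrow> (nat \<Rightarrow> complex mat \<Rightarrow> 'a \<Rightarrow> 'a) \<Rightarrow> complex mat list set" where
  "DY S n d Y A = (\<Union>m\<in>{1..}. Dm S n d Y A m)"

definition Dpath :: "'a::chilbert_space set \<Rightarrow> nat \<Rightarrow> nat \<Rightarrow> complex mat list
    \<Rightarrow> (nat \<Rightarrow> complex mat \<Rightarrow> 'a \<Rightarrow> 'a) \<Rightarrow> complex mat list set" where
  "Dpath S n d Y A = {X. \<exists>m\<ge>1. \<exists>\<gamma>::real \<Rightarrow> complex mat list.
      (\<forall>t\<in>{0..1}. \<gamma> t \<in> Dm S n d Y A m) \<and>
      (\<forall>j<d. \<forall>i<m * n. \<forall>l<m * n. continuous_on {0..1} (\<lambda>t. (\<gamma> t ! j) $$ (i, l))) \<and>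
      \<gamma> 0 = amplt m n Y \<and> \<gamma> 1 = X}"

text \<open>quantized transfer function \<open>(I_m \<otimes> b^*) L_A(X - I_m \<otimes> Y)^{-1} (I_m \<otimes> c)\<close>, as an mn x mn matrix\<close>
definition tf :: "'a::chilbert_space set \<Rightarrow> nat \<Rightarrow> nat \<Rightarrow> complex mat list
    \<Rightarrow> (nat \<Rightarrow> complex mat \<Rightarrow> 'a \<Rightarrow> 'a) \<Rightarrow> (complex vec \<Rightarrow> 'a) \<Rightarrow> (complex vec \<Rightarrow> 'a)
    \<Rightarrow> complex mat list \<Rightarrow> complex mat" where
  "tf S n d Y A b c X =
    (let m = (if n = 0 then 1 else dim_row (X ! 0) div n);
         L = LA n d A m (map2 (-) X (amplt m n Y));
         Linv = the_inv_into (tens m S) L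
     in mat (m * n) (m * n) (\<lambda>(r, s).
          cinner (b (unit_vec n (r mod n)))
                 (Linv (\<lambda>p. if p = s div n then c (unit_vec n (s mod n)) else 0) (r div n))))"

definition realization :: "'a::chilbert_space set \<Rightarrow> nat \<Rightarrow> nat \<Rightarrow> complex mat list
    \<Rightarrow> (nat \<Rightarrow> complex mat \<Rightarrow> 'a \<Rightarrow> 'a) \<Rightarrow> (complex vec \<Rightarrow> 'a) \<Rightarrow> (complex vec \<Rightarrow> 'a) \<Rightarrow> bool" where
  "realization S n d Y A b c \<longleftrightarrow> closed_csubspace S \<and> ncpt d n Y \<and>
     (\<forall>j<d. (\<forall>G\<in>carrier_mat n n. bop S (A j G)) \<and>
        (\<forall>G\<in>carrier_mat n n. \<forall>H\<in>carrier_mat n n. \<forall>x\<in>S. A j (G + H) x = A j G x + A j H x) \<and>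
        (\<forall>a. \<forall>G\<in>carrier_mat n n. \<forall>x\<in>S. A j (a \<cdot>\<^sub>m G) x = a *\<^sub>C A j G x)) \<and>
     (\<forall>f\<in>{b, c}. f ` carrier_vec n \<subseteq> S \<and>
        (\<forall>u\<in>carrier_vec n. \<forall>v\<in>carrier_vec n. f (u + v) = f u + f v) \<and>
        (\<forall>a. \<forall>u\<in>carrier_vec n. f (a \<cdot>\<^sub>v u) = a *\<^sub>C f u))"

fun Aword :: "(nat \<Rightarrow> complex mat \<Rightarrow> 'a \<Rightarrow> 'a) \<Rightarrow> nat list \<Rightarrow> complex mat list \<Rightarrow> 'a \<Rightarrow> 'a" where
  "Aword A (i # w) (G # Gs) x = A i G (Aword A w Gs x)"
| "Aword A _ _ x = x"

fun Adag :: "'a::chilbert_space set \<Rightarrow> (nat \<Rightarrow> complex mat \<Rightarrow> 'a \<Rightarrow> 'a) \<Rightarrow> nat list \<Rightarrow> complex mat list \<Rightarrow> 'a \<Rightarrow> 'a" where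
  "Adag S A (i # w) (G # Gs) x = Adag S A w Gs (adj S (A i (cadj G)) x)"
| "Adag S A _ _ x = x"

definition words :: "nat \<Rightarrow> nat \<Rightarrow> (nat list \<times> complex mat list) set" where
  "words n d = {(w, Gs). set w \<subseteq> {..<d} \<and> length Gs = length w \<and> set Gs \<subseteq> carrier_mat n n}"

definition ctrl :: "nat \<Rightarrow> nat \<Rightarrow> (nat \<Rightarrow> complex mat \<Rightarrow> 'a \<Rightarrow> 'a) \<Rightarrow> (complex vec \<Rightarrow> 'a::chilbert_space) \<Rightarrow> 'a set" where
  "ctrl n d A c = ccspan {Aword A w Gs (c v) | w Gs v. (w, Gs) \<in> words n d \<and> v \<in> carrier_vec n}"

definition obs :: "'a::chilbert_space set \<Rightarrow> nat \<Rightarrow> nat \<Rightarrow> (nat \<Rightarrow> complex mat \<Rightarrow> 'a \<Rightarrow> 'a) \<Rightarrow> (complex vec \<Rightarrow> 'a) \<Rightarrow> 'a set" where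
  "obs S n d A b = ccspan {Adag S A w Gs (b u) | w Gs u. (w, Gs) \<in> words n d \<and> u \<in> carrier_vec n}"

definition minimal :: "'a::chilbert_space set \<Rightarrow> nat \<Rightarrow> nat
    \<Rightarrow> (nat \<Rightarrow> complex mat \<Rightarrow> 'a \<Rightarrow> 'a) \<Rightarrow> (complex vec \<Rightarrow> 'a) \<Rightarrow> (complex vec \<Rightarrow> 'a) \<Rightarrow> bool" where
  "minimal S n d A b c \<longleftrightarrow> ctrl n d A c = S \<and> obs S n d A b = S"

definition minsub :: "'a::chilbert_space set \<Rightarrow> nat \<Rightarrow> nat
    \<Rightarrow> (nat \<Rightarrow> complex mat \<Rightarrow> 'a \<Rightarrow> 'a) \<Rightarrow> (complex vec \<Rightarrow> 'a) \<Rightarrow> (complex vec \<Rightarrow> 'a) \<Rightarrow> 'a set" where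
  "minsub S n d A b c =
     orth_diff (ctrl n d A c) (ctrl n d A c \<inter> orth_diff S (obs S n d A b))"

definition an_equiv :: "'a::chilbert_space set \<Rightarrow> 'b::chilbert_space set \<Rightarrow> nat \<Rightarrow> nat \<Rightarrow> complex mat list
    \<Rightarrow> (nat \<Rightarrow> complex mat \<Rightarrow> 'a \<Rightarrow> 'a) \<Rightarrow> (complex vec \<Rightarrow> 'a) \<Rightarrow> (complex vec \<Rightarrow> 'a)
    \<Rightarrow> (nat \<Rightarrow> complex mat \<Rightarrow> 'b \<Rightarrow> 'b) \<Rightarrow> (complex vec \<Rightarrow> 'b) \<Rightarrow> (complex vec \<Rightarrow> 'b) \<Rightarrow> bool" where
  "an_equiv S S' n d Y A b c A' b' c' \<longleftrightarrow>
     (\<exists>U. uniformly_open d U \<and> Y \<in> U \<and> U \<subseteq> DY S n d Y A \<inter> DY S' n d Y A' \<and>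
          (\<forall>X\<in>U. tf S n d Y A b c X = tf S' n d Y A' b' c' X))"

end

theory Submission
  imports Defs
begin

text \<open>Write \<open>C\<close> for the controllable subspace, \<open>O\<close> for the observable one, \<open>N = C \<inter> O\<^sup>\<bottom>\<close> and \<open>Q\<close> for
  the projection onto the minimal subspace \<open>M = C \<ominus> N\<close>. Both \<open>C\<close> and \<open>N\<close> are invariant under all
  \<open>A_j(G)\<close>, and \<open>x - Q x \<in> N\<close> for \<open>x \<in> C\<close>, so \<open>Q A_j(G) Q = Q A_j(G)\<close> on \<open>C\<close>; minimality follows word
  by word. If \<open>v \<in> \<complex>^m \<otimes> C\<close> solves \<open>L_A v = c\<close>, then \<open>Q v\<close> solves the compressed equation and gives
  the same value of the transfer function. It remains to see that \<open>L_A^{-1}\<close> preserves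
  \<open>\<complex>^m \<otimes> C\<close>: near the centre by the Neumann series, and on the whole path component by
  the method of continuity. Thus no analytic continuation is needed, and the two paths to \<open>X\<close>
  inside the two domains need not be related.\<close>

section \<open>Hilbert space geometry\<close>

text \<open>An invertible operator can map a closed invariant subspace properly into itself, as the
  bilateral shift does with a half-space. So invertibility of \<open>LA\<close> on the whole space
  does not by itself place the solution of the defining equation in the controllable subspace.
  Invertibility is therefore split into a lower bound, which every subspace inherits, and
  surjectivity, which alone can be lost; under small perturbations of an operator with a lower
  bound, surjectivity can be neither lost nor gained. A uniform neighbourhood needs one radius for
  all \<open>m\<close>. The blocks are expanded in the \<open>n * n\<close> matrix units; for each
  unit the coefficients form an \<open>m\<close> by \<open>m\<close> matrix that is a compression of
  the given one, and tensoring a scalar matrix with the identity of the Hilbert space does not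
  increase its norm. The cost is a factor that depends on \<open>n\<close>, \<open>d\<close> and
  \<open>A\<close>, but not on \<open>m\<close>.\<close>

lemma scaleC_zero_left [simp]: "0 *\<^sub>C x = (0::'a::complex_vector)"
  using scaleR_scaleC[of 0 x] by simp

lemma scaleC_zero_right [simp]: "a *\<^sub>C 0 = (0::'a::complex_vector)"
  using scaleC_add_right[of a 0 0] by simp

lemma scaleC_one' [simp]: "1 *\<^sub>C x = (x::'a::complex_vector)"
  by (rule scaleC_one)

lemma scaleC_minus1: "(-1) *\<^sub>C x = - (x::'a::complex_vector)"
  using scaleR_scaleC[of "-1" x] by simp

lemma scaleC_diff_right: "a *\<^sub>C (x - y) = a *\<^sub>C x - a *\<^sub>C (y::'a::complex_vector)"
  using scaleC_add_right[of a "x - y" y] by (simp add: algebra_simps)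

lemma scaleC_sum_right: "a *\<^sub>C (\<Sum>i\<in>I. f i) = (\<Sum>i\<in>I. a *\<^sub>C (f i::'a::complex_vector))"
  by (induction I rule: infinite_finite_induct) (auto simp: scaleC_add_right)

lemma scaleC_sum_left: "(\<Sum>i\<in>I. f i) *\<^sub>C x = (\<Sum>i\<in>I. f i *\<^sub>C (x::'a::complex_vector))"
  by (induction I rule: infinite_finite_induct) (auto simp: scaleC_add_left)

lemma cinner_add_left: "cinner (x + y) (z::'a::complex_inner) = cinner x z + cinner y z"
  by (metis cinner_add_right cinner_commute complex_cnj_add)

lemma cinner_scaleC_left: "cinner (a *\<^sub>C x) (z::'a::complex_inner) = cnj a * cinner x z"
  by (metis cinner_scaleC_right cinner_commute complex_cnj_mult)

lemma cinner_zero_right [simp]: "cinner x (0::'a::complex_inner) = 0"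
  using cinner_add_right[of x 0 0] by simp

lemma cinner_zero_left [simp]: "cinner (0::'a::complex_inner) x = 0"
  using cinner_add_left[of 0 0 x] by simp

lemma cinner_minus_right: "cinner x (- y::'a::complex_inner) = - cinner x y"
  using cinner_add_right[of x "- y" y] by (simp add: eq_neg_iff_add_eq_0)

lemma cinner_minus_left: "cinner (- y::'a::complex_inner) x = - cinner y x"
  using cinner_add_left[of "- y" y x] by (simp add: eq_neg_iff_add_eq_0)

lemma cinner_diff_right: "cinner x (y - z::'a::complex_inner) = cinner x y - cinner x z"
  using cinner_add_right[of x y "- z"] by (simp add: cinner_minus_right)

lemma cinner_diff_left: "cinner (y - z::'a::complex_inner) x = cinner y x - cinner z x"
  using cinner_add_left[of y "- z" x] by (simp add: cinner_minus_left)

lemma cinner_sum_right: "cinner x (\<Sum>i\<in>I. f i) = (\<Sum>i\<in>I. cinner x (f i::'a::complex_inner))"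
  by (induction I rule: infinite_finite_induct) (auto simp: cinner_add_right)

lemma cinner_sum_left: "cinner (\<Sum>i\<in>I. f i) x = (\<Sum>i\<in>I. cinner (f i::'a::complex_inner) x)"
  by (induction I rule: infinite_finite_induct) (auto simp: cinner_add_left)

lemma cinner_self: "cinner x (x::'a::complex_inner) = of_real ((norm x)\<^sup>2)"
proof -
  have "Im (cinner x x) = 0"
    using cinner_commute[of x x] by (simp add: complex_eq_iff)
  then show ?thesis
    by (simp add: norm_eq_sqrt_cinner cinner_ge_zero complex_eq_iff)
qed

lemma norm_sq_cinner: "(norm (x::'a::complex_inner))\<^sup>2 = Re (cinner x x)"
  by (simp add: cinner_self)

lemma norm_scaleC [simp]: "norm (a *\<^sub>C (x::'a::complex_inner)) = cmod a * norm x"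
proof -
  have "of_real ((norm (a *\<^sub>C x))\<^sup>2) = (of_real ((cmod a * norm x)\<^sup>2) :: complex)"
    unfolding cinner_self[symmetric]
    by (simp add: cinner_scaleC_left cinner_scaleC_right cinner_self[of x] power_mult_distrib
        complex_norm_square mult_ac del: of_real_power)
  then have "(norm (a *\<^sub>C x))\<^sup>2 = (cmod a * norm x)\<^sup>2"
    using of_real_eq_iff by blast
  then show ?thesis
    by (simp add: power2_eq_iff_nonneg)
qed

lemma pythagoras:
  fixes x y :: "'a::complex_inner"
  assumes "cinner x y = 0"
  shows "(norm (x + y))\<^sup>2 = (norm x)\<^sup>2 + (norm y)\<^sup>2"
proof -
  have "cinner y x = 0" using assms cinner_commute[of y x] by simp
  then show ?thesis using assms
    by (simp add: norm_sq_cinner cinner_add_left cinner_add_right)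
qed

lemma cauchy_schwarz: "cmod (cinner x y) \<le> norm x * norm (y::'a::complex_inner)"
proof (cases "x = 0")
  case False
  \<comment> \<open>With this coefficient \<open>z\<close> is the part of \<open>y\<close>
    orthogonal to \<open>x\<close>.\<close>
  define a where "a = cinner x y / cinner x x"
  define z where "z = y - a *\<^sub>C x"
  have ne: "cinner x x \<noteq> 0" using False by (simp add: cinner_eq_zero_iff)
  have "cinner (a *\<^sub>C x) z = 0"
    using ne by (simp add: z_def a_def cinner_diff_right cinner_scaleC_left cinner_scaleC_right)
  then have "(norm (a *\<^sub>C x + z))\<^sup>2 = (norm (a *\<^sub>C x))\<^sup>2 + (norm z)\<^sup>2"
    by (rule pythagoras)
  then have "(norm (a *\<^sub>C x))\<^sup>2 \<le> (norm y)\<^sup>2"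
    by (simp add: z_def)
  then have "cmod a * norm x \<le> norm y"
    using power2_le_imp_le[of "norm (a *\<^sub>C x)" "norm y"] by simp
  moreover have "cmod a = cmod (cinner x y) / (norm x)\<^sup>2"
    by (simp add: a_def cinner_self norm_divide norm_power)
  ultimately show ?thesis
    using False by (simp add: field_simps power2_eq_square)
qed simp

lemma parallelogram:
  "(norm (x - y))\<^sup>2 + (norm (x + y))\<^sup>2 = 2 * (norm x)\<^sup>2 + 2 * (norm (y::'a::complex_inner))\<^sup>2"
  by (simp add: norm_sq_cinner cinner_add_left cinner_add_right cinner_diff_left cinner_diff_right)

section \<open>Complex subspaces and orthogonal projection\<close>

lemma csubspace_0: "csubspace S \<Longrightarrow> 0 \<in> S"
  and csubspace_add: "csubspace S \<Longrightarrow> x \<in> S \<Longrightarrow> y \<in> S \<Longrightarrow> x + y \<in> S"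
  and csubspace_scaleC: "csubspace S \<Longrightarrow> x \<in> S \<Longrightarrow> a *\<^sub>C x \<in> S"
  by (auto simp: csubspace_def)

lemma csubspace_scaleR: "csubspace S \<Longrightarrow> x \<in> S \<Longrightarrow> r *\<^sub>R x \<in> S"
  by (simp add: scaleR_scaleC csubspace_scaleC)

lemma csubspace_diff: "csubspace S \<Longrightarrow> x \<in> S \<Longrightarrow> y \<in> S \<Longrightarrow> x - y \<in> S"
  using csubspace_add[of S x "(-1) *\<^sub>C y"] csubspace_scaleC[of S y "-1"]
  by (simp add: scaleC_minus1)

lemma csubspace_sum: "csubspace S \<Longrightarrow> (\<And>i. i \<in> I \<Longrightarrow> f i \<in> S) \<Longrightarrow> sum f I \<in> S"
  by (induction I rule: infinite_finite_induct) (auto simp: csubspace_0 csubspace_add)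

lemma closed_csubspace_UNIV: "closed_csubspace (UNIV :: 'a::chilbert_space set)"
  by (simp add: closed_csubspace_def csubspace_def)

lemma closed_csubspace_Int:
  "closed_csubspace S \<Longrightarrow> closed_csubspace T \<Longrightarrow> closed_csubspace (S \<inter> T)"
  by (auto simp: closed_csubspace_def csubspace_def)

lemma minimizing_sequence_Cauchy:
  fixes y :: "nat \<Rightarrow> 'a::complex_inner"
  assumes S: "csubspace S" and yS: "\<And>i. y i \<in> S"
    and lower: "\<And>z. z \<in> S \<Longrightarrow> \<delta> \<le> (norm (x - z))\<^sup>2"
    and upper: "\<And>i. (norm (x - y i))\<^sup>2 \<le> \<delta> + inverse (real (Suc i))"
  shows "Cauchy y"
proof (rule metric_CauchyI)
  have est: "(norm (y i - y j))\<^sup>2 \<le> 4 * inverse (real (Suc k))" if "i \<ge> k" "j \<ge> k" for i j k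
  proof -
    \<comment> \<open>The midpoint stays in \<open>S\<close>, so its distance to \<open>x\<close> is
      bounded below by the infimum; the parallelogram law then leaves no room for \<open>y i\<close>
      and \<open>y j\<close> to be far apart.\<close>
    define w where "w = (1/2) *\<^sub>R (y i + y j)"
    have "w \<in> S" unfolding w_def by (intro csubspace_scaleR csubspace_add S yS)
    then have "\<delta> \<le> (norm (x - w))\<^sup>2" by (rule lower)
    moreover have "(x - y i) + (x - y j) = 2 *\<^sub>R (x - w)"
      by (simp add: w_def algebra_simps scaleR_2)
    then have "(norm ((x - y i) + (x - y j)))\<^sup>2 = 4 * (norm (x - w))\<^sup>2"
      by (simp add: power_mult_distrib)
    ultimately have "4 * \<delta> \<le> (norm ((x - y i) + (x - y j)))\<^sup>2" by simp
    then have "(norm ((x - y i) - (x - y j)))\<^sup>2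
        \<le> 2 * inverse (real (Suc i)) + 2 * inverse (real (Suc j))"
      using parallelogram[of "x - y i" "x - y j"] upper[of i] upper[of j] by linarith
    moreover have "inverse (real (Suc i)) \<le> inverse (real (Suc k))"
        "inverse (real (Suc j)) \<le> inverse (real (Suc k))"
      using that by (auto intro!: le_imp_inverse_le)
    moreover have "(x - y i) - (x - y j) = - (y i - y j)" by simp
    ultimately show ?thesis by (simp only: norm_minus_cancel)
  qed
  fix e :: real assume "0 < e"
  then have "0 < e\<^sup>2 / 4" by simp
  from reals_Archimedean[OF this] obtain k where k: "inverse (real (Suc k)) < e\<^sup>2 / 4" by blast
  show "\<exists>M. \<forall>i\<ge>M. \<forall>j\<ge>M. dist (y i) (y j) < e"
  proof (intro exI allI impI)
    fix i j assume "i \<ge> k" "j \<ge> k"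
    then have "(norm (y i - y j))\<^sup>2 \<le> 4 * inverse (real (Suc k))" by (rule est)
    also have "\<dots> < e\<^sup>2" using k by simp
    finally have "(norm (y i - y j))\<^sup>2 < e\<^sup>2" .
    then show "dist (y i) (y j) < e"
      unfolding dist_norm using \<open>0 < e\<close> by (auto dest: power2_less_imp_less)
  qed
qed

text \<open>If \<open>x - y\<close> had a nonzero component along \<open>z\<close>, moving
  \<open>y\<close> by that component would bring it strictly closer to \<open>x\<close>, by
  Pythagoras.\<close>

lemma nearest_point_orthogonal:
  fixes x y :: "'a::complex_inner"
  assumes S: "csubspace S" and y: "y \<in> S"
    and lower: "\<And>z. z \<in> S \<Longrightarrow> norm (x - y) \<le> norm (x - z)" and z: "z \<in> S"
  shows "cinner z (x - y) = 0"
proof (cases "z = 0")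
  case False
  define a where "a = cinner z (x - y) / cinner z z"
  have ne: "cinner z z \<noteq> 0" using False by (simp add: cinner_eq_zero_iff)
  define u where "u = (x - y) - a *\<^sub>C z"
  have "cinner (a *\<^sub>C z) u = 0"
    using ne by (simp add: u_def a_def cinner_diff_right[of _ "x - y"] cinner_scaleC_left cinner_scaleC_right)
  then have "(norm (a *\<^sub>C z + u))\<^sup>2 = (norm (a *\<^sub>C z))\<^sup>2 + (norm u)\<^sup>2"
    by (rule pythagoras)
  moreover have "norm (x - y) \<le> norm (x - (y + a *\<^sub>C z))"
    by (intro lower csubspace_add csubspace_scaleC S y z)
  then have "(norm (x - y))\<^sup>2 \<le> (norm u)\<^sup>2"
    by (intro power_mono) (auto simp: u_def algebra_simps)
  ultimately have "(norm (a *\<^sub>C z))\<^sup>2 \<le> 0" by (simp add: u_def)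
  then have "a = 0" using False by simp
  then show ?thesis using ne by (simp add: a_def)
qed simp

lemma orthogonal_projection_exists:
  fixes x :: "'a::chilbert_space"
  assumes "closed_csubspace S"
  obtains y where "y \<in> S" "\<And>z. z \<in> S \<Longrightarrow> cinner z (x - y) = 0"
proof -
  have S: "csubspace S" and cl: "closed S" using assms by (auto simp: closed_csubspace_def)
  \<comment> \<open>Squared distances are minimized because the parallelogram law is stated for
    squares.\<close>
  define D where "D = (\<lambda>z. (norm (x - z))\<^sup>2) ` S"
  define \<delta> where "\<delta> = Inf D"
  have ne: "D \<noteq> {}" using csubspace_0[OF S] by (auto simp: D_def)
  have bdd: "bdd_below D" by (auto simp: D_def intro!: bdd_belowI[of _ 0])
  have lower: "\<delta> \<le> (norm (x - z))\<^sup>2" if "z \<in> S" for z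
    unfolding \<delta>_def using that by (intro cInf_lower bdd) (auto simp: D_def)
  have "\<exists>y\<in>S. (norm (x - y))\<^sup>2 \<le> \<delta> + inverse (real (Suc i))" for i
  proof -
    have "Inf D < \<delta> + inverse (real (Suc i))" by (simp add: \<delta>_def)
    then obtain t where "t \<in> D" "t < \<delta> + inverse (real (Suc i))"
      using cInf_lessD[OF ne] by blast
    then show ?thesis by (auto simp: D_def intro: less_imp_le)
  qed
  then obtain y where y: "\<And>i. y i \<in> S" "\<And>i. (norm (x - y i))\<^sup>2 \<le> \<delta> + inverse (real (Suc i))"
    by metis
  have "Cauchy y" by (rule minimizing_sequence_Cauchy[OF S y(1) lower y(2)])
  then obtain l where l: "y \<longlonglongrightarrow> l" by (meson Cauchy_convergent convergent_def)
  have lS: "l \<in> S" using closed_sequentially[OF cl] y(1) l by blast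
  have "(\<lambda>i. (norm (x - y i))\<^sup>2) \<longlonglongrightarrow> (norm (x - l))\<^sup>2" by (intro tendsto_intros l)
  moreover have "(\<lambda>i. \<delta> + inverse (real (Suc i))) \<longlonglongrightarrow> \<delta> + 0"
    by (intro tendsto_intros LIMSEQ_inverse_real_of_nat)
  ultimately have "(norm (x - l))\<^sup>2 \<le> \<delta> + 0"
    by (rule LIMSEQ_le) (use y(2) in auto)
  then have "(norm (x - l))\<^sup>2 \<le> (norm (x - z))\<^sup>2" if "z \<in> S" for z
    using lower[OF that] by linarith
  then have "norm (x - l) \<le> norm (x - z)" if "z \<in> S" for z
    using that by (blast intro: power2_le_imp_le norm_ge_zero)
  then show thesis
    using that[OF lS] nearest_point_orthogonal[OF S lS] by blast
qed

text \<open>The difference of two candidates lies in \<open>S\<close> and is orthogonal to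
  \<open>S\<close>, hence to itself. This makes the definite description in \<open>proj\<close>
  meaningful.\<close>

lemma orthogonal_projection_unique:
  fixes x :: "'a::chilbert_space"
  assumes S: "csubspace S" and "y \<in> S" "\<And>z. z \<in> S \<Longrightarrow> cinner z (x - y) = 0"
    and "y' \<in> S" "\<And>z. z \<in> S \<Longrightarrow> cinner z (x - y') = 0"
  shows "y = y'"
proof -
  have "y - y' \<in> S" using assms by (simp add: csubspace_diff)
  then have "cinner (y - y') ((x - y') - (x - y)) = 0"
    unfolding cinner_diff_right[of _ "x - y'"] using assms(3,5) by simp
  then show ?thesis by (simp add: cinner_eq_zero_iff)
qed

lemma proj_eqI:
  assumes "closed_csubspace S" "y \<in> S" "\<And>z. z \<in> S \<Longrightarrow> cinner z (x - y) = 0"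
  shows "proj S x = y"
  unfolding proj_def
proof (rule the_equality)
  show "y \<in> S \<and> (\<forall>z\<in>S. cinner z (x - y) = 0)" using assms by blast
  fix y' assume y': "y' \<in> S \<and> (\<forall>z\<in>S. cinner z (x - y') = 0)"
  have "csubspace S" using assms(1) by (simp add: closed_csubspace_def)
  then show "y' = y"
    by (rule orthogonal_projection_unique[where x = x]) (use y' assms(2,3) in blast)+
qed

context
  fixes S :: "'a::chilbert_space set"
  assumes S: "closed_csubspace S"
begin

lemma proj_in: "proj S x \<in> S"
  and proj_orthogonal: "z \<in> S \<Longrightarrow> cinner z (x - proj S x) = 0"
proof -
  obtain y where y: "y \<in> S" "\<And>z. z \<in> S \<Longrightarrow> cinner z (x - y) = 0"
    using orthogonal_projection_exists[OF S] by blast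
  then have eq: "proj S x = y" by (rule proj_eqI[OF S])
  show "proj S x \<in> S" "z \<in> S \<Longrightarrow> cinner z (x - proj S x) = 0"
    unfolding eq using y by blast+
qed

lemma proj_ident: "x \<in> S \<Longrightarrow> proj S x = x"
  by (intro proj_eqI S) auto

lemma proj_eq_0: "(\<And>z. z \<in> S \<Longrightarrow> cinner z x = 0) \<Longrightarrow> proj S x = 0"
  using S by (intro proj_eqI S) (auto simp: closed_csubspace_def csubspace_0)

lemma proj_zero [simp]: "proj S 0 = 0"
  by (rule proj_eq_0) simp

lemma proj_add: "proj S (x + y) = proj S x + proj S y"
proof (rule proj_eqI[OF S])
  show "proj S x + proj S y \<in> S"
    using S by (intro csubspace_add proj_in) (auto simp: closed_csubspace_def)
  fix z assume "z \<in> S"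
  then show "cinner z (x + y - (proj S x + proj S y)) = 0"
    using cinner_add_right[of z "x - proj S x" "y - proj S y"] proj_orthogonal[of z]
    by (simp add: algebra_simps)
qed

lemma proj_scaleC: "proj S (a *\<^sub>C x) = a *\<^sub>C proj S x"
proof (rule proj_eqI[OF S])
  show "a *\<^sub>C proj S x \<in> S"
    using S by (intro csubspace_scaleC proj_in) (auto simp: closed_csubspace_def)
  fix z assume "z \<in> S"
  then show "cinner z (a *\<^sub>C x - a *\<^sub>C proj S x) = 0"
    unfolding scaleC_diff_right[symmetric] cinner_scaleC_right by (simp add: proj_orthogonal)
qed

lemma proj_diff: "proj S (x - y) = proj S x - proj S y"
  using proj_add[of "x - y" y] by (simp add: algebra_simps)

lemma proj_sum: "proj S (\<Sum>i\<in>I. f i) = (\<Sum>i\<in>I. proj S (f i))"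
  by (induction I rule: infinite_finite_induct) (auto simp: proj_add)

lemma norm_proj_le: "norm (proj S x) \<le> norm x"
proof -
  have "(norm (proj S x + (x - proj S x)))\<^sup>2 = (norm (proj S x))\<^sup>2 + (norm (x - proj S x))\<^sup>2"
    by (intro pythagoras proj_orthogonal proj_in)
  moreover have "proj S x + (x - proj S x) = x" by simp
  ultimately have "(norm (proj S x))\<^sup>2 \<le> (norm x)\<^sup>2" by (metis le_add_same_cancel1 zero_le_power2)
  then show ?thesis by (rule power2_le_imp_le) simp
qed

lemma cinner_proj_left: "z \<in> S \<Longrightarrow> cinner (proj S x) z = cinner x z"
  using proj_orthogonal[of z x] cinner_commute[of "x - proj S x" z] by (simp add: cinner_diff_left)

end

section \<open>Orthogonal complements and closed spans\<close>

lemma tendsto_cinner_right: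
  "(f \<longlongrightarrow> (l::'a::complex_inner)) F \<Longrightarrow> ((\<lambda>i. cinner x (f i)) \<longlongrightarrow> cinner x l) F"
proof (rule Lim_transform_bound[where g = "\<lambda>i. norm x * norm (f i - l)", THEN LIM_zero_cancel])
  show "\<forall>\<^sub>F i in F. norm (cinner x (f i) - cinner x l) \<le> norm (norm x * norm (f i - l))"
    using cauchy_schwarz[of x] by (simp flip: cinner_diff_right)
  assume "(f \<longlongrightarrow> l) F"
  then show "((\<lambda>i. norm x * norm (f i - l)) \<longlongrightarrow> 0) F"
    by (intro tendsto_mult_right_zero tendsto_norm_zero LIM_zero)
qed

lemma closed_csubspace_orth_diff:
  assumes "closed_csubspace V"
  shows "closed_csubspace (orth_diff V W)"
proof -
  have cs: "csubspace V" and cl: "closed V" using assms by (auto simp: closed_csubspace_def)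
  have "closed (orth_diff V W)"
    unfolding closed_sequential_limits
  proof (intro allI impI, elim conjE)
    fix x l assume x: "\<forall>i. x i \<in> orth_diff V W" and l: "x \<longlonglongrightarrow> l"
    have "l \<in> V" using closed_sequentially[OF cl _ l] x by (auto simp: orth_diff_def)
    moreover have "cinner w l = 0" if "w \<in> W" for w
    proof -
      have "(\<lambda>i. cinner w (x i)) = (\<lambda>i. 0)" using x that by (auto simp: orth_diff_def)
      then show ?thesis using tendsto_cinner_right[OF l, of w] by (simp add: LIMSEQ_const_iff)
    qed
    ultimately show "l \<in> orth_diff V W" by (simp add: orth_diff_def)
  qed
  moreover have "csubspace (orth_diff V W)"
    unfolding csubspace_def orth_diff_def
    using cs by (auto simp: csubspace_0 csubspace_add csubspace_scaleC cinner_add_right cinner_scaleC_right)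
  ultimately show ?thesis by (simp add: closed_csubspace_def)
qed

lemma csubspace_cspan: "csubspace (cspan (W::'a::complex_vector set))"
  unfolding csubspace_def
proof (intro conjI ballI allI)
  show "0 \<in> cspan W" unfolding cspan_def by (auto intro!: exI[of _ "{}"])
next
  fix x y assume "x \<in> cspan W" "y \<in> cspan W"
  then obtain F a G b where F: "finite F" "F \<subseteq> W" "x = (\<Sum>v\<in>F. a v *\<^sub>C v)"
    and G: "finite G" "G \<subseteq> W" "y = (\<Sum>v\<in>G. b v *\<^sub>C v)"
    unfolding cspan_def by blast
  \<comment> \<open>The two finite supports may overlap, so both coefficient families are extended
    by zero to the union before they are added.\<close>
  define e where "e v = (if v \<in> F then a v else 0) + (if v \<in> G then b v else 0)" for v
  have "x = (\<Sum>v\<in>F\<union>G. (if v \<in> F then a v else 0) *\<^sub>C v)"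
    using F G by (auto intro!: sum.mono_neutral_cong_left)
  moreover have "y = (\<Sum>v\<in>F\<union>G. (if v \<in> G then b v else 0) *\<^sub>C v)"
    using F G by (auto intro!: sum.mono_neutral_cong_left)
  ultimately have "x + y = (\<Sum>v\<in>F\<union>G. e v *\<^sub>C v)"
    by (simp add: e_def scaleC_add_left sum.distrib)
  then show "x + y \<in> cspan W"
    unfolding cspan_def using F G by (intro CollectI exI[of _ "F \<union> G"] exI[of _ e]) auto
next
  fix a x assume "x \<in> cspan W"
  then obtain F b where F: "finite F" "F \<subseteq> W" "x = (\<Sum>v\<in>F. b v *\<^sub>C v)"
    unfolding cspan_def by blast
  then have "a *\<^sub>C x = (\<Sum>v\<in>F. (a * b v) *\<^sub>C v)" by (simp add: scaleC_sum_right scaleC_scaleC)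
  then show "a *\<^sub>C x \<in> cspan W"
    unfolding cspan_def using F by (intro CollectI exI[of _ F] exI[of _ "\<lambda>v. a * b v"]) auto
qed

lemma cspan_superset: "W \<subseteq> cspan (W::'a::complex_vector set)"
  unfolding cspan_def by (auto intro!: exI[of _ "{x}" for x] exI[of _ "\<lambda>_. 1"])

lemma cspan_minimal: "csubspace S \<Longrightarrow> W \<subseteq> S \<Longrightarrow> cspan W \<subseteq> S"
  unfolding cspan_def by (auto intro!: csubspace_sum csubspace_scaleC)

lemma tendsto_scaleC:
  assumes "(f \<longlongrightarrow> (l::'a::complex_inner)) F"
  shows "((\<lambda>i. a *\<^sub>C f i) \<longlongrightarrow> a *\<^sub>C l) F"
proof (rule LIM_zero_cancel, rule tendsto_norm_zero_cancel)
  have "((\<lambda>i. cmod a * norm (f i - l)) \<longlongrightarrow> 0) F"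
    by (intro tendsto_mult_right_zero tendsto_norm_zero LIM_zero assms)
  then show "((\<lambda>i. norm (a *\<^sub>C f i - a *\<^sub>C l)) \<longlongrightarrow> 0) F"
    by (simp flip: scaleC_diff_right)
qed

lemma closed_csubspace_ccspan: "closed_csubspace (ccspan W)"
proof -
  note cs = csubspace_cspan[of W]
  have "csubspace (closure (cspan W))"
    unfolding csubspace_def
  proof (intro conjI ballI allI)
    show "0 \<in> closure (cspan W)" using csubspace_0[OF cs] closure_subset by blast
  next
    fix x y assume "x \<in> closure (cspan W)" "y \<in> closure (cspan W)"
    then obtain f g where "\<And>i. f i \<in> cspan W" "f \<longlonglongrightarrow> x" "\<And>i. g i \<in> cspan W" "g \<longlonglongrightarrow> y"
      unfolding closure_sequential by blast
    then show "x + y \<in> closure (cspan W)"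
      unfolding closure_sequential
      by (intro exI[of _ "\<lambda>i. f i + g i"]) (auto intro: csubspace_add cs tendsto_add)
  next
    fix a x assume "x \<in> closure (cspan W)"
    then obtain f where "\<And>i. f i \<in> cspan W" "f \<longlonglongrightarrow> x"
      unfolding closure_sequential by blast
    then show "a *\<^sub>C x \<in> closure (cspan W)"
      unfolding closure_sequential
      by (intro exI[of _ "\<lambda>i. a *\<^sub>C f i"]) (auto intro: csubspace_scaleC cs tendsto_scaleC)
  qed
  then show ?thesis by (simp add: closed_csubspace_def ccspan_def)
qed

lemma ccspan_superset: "W \<subseteq> ccspan W"
  unfolding ccspan_def using cspan_superset closure_subset by blast

lemma ccspan_minimal: "closed_csubspace S \<Longrightarrow> W \<subseteq> S \<Longrightarrow> ccspan W \<subseteq> S"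
  unfolding ccspan_def closed_csubspace_def by (meson closure_minimal cspan_minimal)

section \<open>Riesz representation and adjoints\<close>

lemma riesz_representation:
  fixes \<phi> :: "'a::chilbert_space \<Rightarrow> complex"
  assumes S: "closed_csubspace S"
    and add: "\<And>x y. x \<in> S \<Longrightarrow> y \<in> S \<Longrightarrow> \<phi> (x + y) = \<phi> x + \<phi> y"
    and scale: "\<And>a x. x \<in> S \<Longrightarrow> \<phi> (a *\<^sub>C x) = a * \<phi> x"
    and bound: "\<And>x. x \<in> S \<Longrightarrow> cmod (\<phi> x) \<le> B * norm x"
  obtains z where "z \<in> S" "\<And>x. x \<in> S \<Longrightarrow> \<phi> x = cinner z x"
proof -
  have cs: "csubspace S" and cl: "closed S" using S by (auto simp: closed_csubspace_def)
  have zero: "\<phi> 0 = 0" using scale[OF csubspace_0[OF cs], of 0] by simp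
  have diff: "\<phi> (x - y) = \<phi> x - \<phi> y" if "x \<in> S" "y \<in> S" for x y
    using add[of "x - y" y] that by (simp add: csubspace_diff[OF cs])
  \<comment> \<open>A functional is determined by its kernel and one value off the kernel. The bound
    \<open>B\<close> makes the kernel closed, so that a vector \<open>e\<close> orthogonal to it can
    be found by projection.\<close>
  define K where "K = {x \<in> S. \<phi> x = 0}"
  have "csubspace K"
    unfolding csubspace_def K_def
    by (auto simp: csubspace_0[OF cs] csubspace_add[OF cs] csubspace_scaleC[OF cs] add scale zero)
  moreover have "closed K"
    unfolding closed_sequential_limits
  proof (intro allI impI, elim conjE)
    fix f l assume f: "\<forall>i. f i \<in> K" and l: "f \<longlonglongrightarrow> l"
    have lS: "l \<in> S" using closed_sequentially[OF cl _ l] f by (auto simp: K_def)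
    have "cmod (\<phi> l) \<le> B * norm (l - f i)" for i
      using f bound[of "l - f i"] diff[of l "f i"] lS by (auto simp: K_def csubspace_diff[OF cs])
    moreover have "(\<lambda>i. B * norm (l - f i)) \<longlonglongrightarrow> B * norm (l - l)" by (intro tendsto_intros l)
    ultimately have "cmod (\<phi> l) \<le> B * norm (l - l)" by (intro LIMSEQ_le_const) auto
    then show "l \<in> K" using lS by (simp add: K_def)
  qed
  ultimately have K: "closed_csubspace K" by (simp add: closed_csubspace_def)
  show thesis
  proof (cases "S \<subseteq> K")
    case True
    then show thesis using that[of 0] csubspace_0[OF cs] by (auto simp: K_def)
  next
    case False
    then obtain x0 where x0: "x0 \<in> S" "x0 \<notin> K" by blast
    define e where "e = x0 - proj K x0"
    have pK: "proj K x0 \<in> K" by (rule proj_in[OF K])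
    then have eS: "e \<in> S" using x0 by (simp add: e_def K_def csubspace_diff[OF cs])
    have \<phi>e: "\<phi> e \<noteq> 0" using x0 pK diff[of x0 "proj K x0"] by (auto simp: e_def K_def)
    then have ne: "cinner e e \<noteq> 0" using zero by (auto simp: cinner_eq_zero_iff)
    \<comment> \<open>The conjugate compensates for \<open>cinner\<close> being conjugate-linear in
      its first argument; the factor is fixed by the value at \<open>e\<close>.\<close>
    define z where "z = cnj (\<phi> e / cinner e e) *\<^sub>C e"
    have "\<phi> x = cinner z x" if x: "x \<in> S" for x
    proof -
      define u where "u = x - (\<phi> x / \<phi> e) *\<^sub>C e"
      have "u \<in> K" using x eS \<phi>e
        by (simp add: u_def K_def csubspace_diff[OF cs] csubspace_scaleC[OF cs] diff scale)
      then have "cinner u e = 0" unfolding e_def by (rule proj_orthogonal[OF K])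
      then have "cinner e u = 0" using cinner_commute[of e u] by simp
      then have "cinner e x = \<phi> x / \<phi> e * cinner e e"
        by (simp add: u_def cinner_diff_right cinner_scaleC_right)
      then show ?thesis using \<phi>e ne by (simp add: z_def cinner_scaleC_left)
    qed
    moreover have "z \<in> S" using eS by (simp add: z_def csubspace_scaleC[OF cs])
    ultimately show thesis using that by blast
  qed
qed

text \<open>Riesz representation of the bounded functional that sends \<open>x\<close> to
  \<open>cinner y (T x)\<close> yields a vector with the defining property of \<open>adj\<close>.
  Since \<open>adj\<close> is a definite description, uniqueness within \<open>S\<close> has to be
  shown as well.\<close>

lemma
  assumes S: "closed_csubspace S" and T: "bop S T"
  shows adj_in: "adj S T y \<in> S"
    and cinner_adj: "x \<in> S \<Longrightarrow> cinner (T x) y = cinner x (adj S T y)"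
proof -
  have cs: "csubspace S" using S by (simp add: closed_csubspace_def)
  from T obtain K where K: "\<And>x. x \<in> S \<Longrightarrow> norm (T x) \<le> K * norm x" unfolding bop_def by blast
  obtain z where z: "z \<in> S" "\<And>x. x \<in> S \<Longrightarrow> cinner y (T x) = cinner z x"
  proof (rule riesz_representation[OF S, of "\<lambda>x. cinner y (T x)" "norm y * K"])
    fix x assume "x \<in> S"
    have "cmod (cinner y (T x)) \<le> norm y * norm (T x)" by (rule cauchy_schwarz)
    also have "\<dots> \<le> norm y * (K * norm x)" by (intro mult_left_mono K \<open>x \<in> S\<close> norm_ge_zero)
    finally show "cmod (cinner y (T x)) \<le> norm y * K * norm x" by (simp add: mult_ac)
  qed (use T in \<open>auto simp: bop_def cinner_add_right cinner_scaleC_right\<close>)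
  have eq: "cinner (T x) y = cinner x z" if "x \<in> S" for x
    using z(2)[OF that] by (metis cinner_commute)
  have "adj S T y = z"
    unfolding adj_def
  proof (rule the_equality)
    show "z \<in> S \<and> (\<forall>x\<in>S. cinner (T x) y = cinner x z)" using z eq by blast
    fix w assume w: "w \<in> S \<and> (\<forall>x\<in>S. cinner (T x) y = cinner x w)"
    then have "cinner (w - z) (w - z) = 0"
      unfolding cinner_diff_right[of _ w] using eq[of "w - z"] z csubspace_diff[OF cs, of w z] by simp
    then show "w = z" by (simp add: cinner_eq_zero_iff)
  qed
  then show "adj S T y \<in> S" "x \<in> S \<Longrightarrow> cinner (T x) y = cinner x (adj S T y)"
    using z eq by auto
qed

section \<open>Perturbation of invertible operators on amplified spaces\<close>

text \<open>The comparison test for series, applied to the Neumann series in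
  \<open>perturb_surj\<close>, asks for the class \<open>banach\<close>.\<close>

instance chilbert_space \<subseteq> banach ..

section \<open>The norm of an amplified space\<close>

lemma tnorm_L2_set: "tnorm m v = L2_set (\<lambda>p. norm (v p)) {..<m}"
  by (simp add: tnorm_def L2_set_def)

lemma tnorm_nonneg [simp]: "0 \<le> tnorm m v"
  by (simp add: tnorm_L2_set)

lemma tnorm_zero [simp]: "tnorm m (\<lambda>p. 0) = 0"
  by (simp add: tnorm_def)

lemma tnorm_triangle: "tnorm m (\<lambda>p. u p + v p) \<le> tnorm m u + tnorm m v"
proof -
  have "tnorm m (\<lambda>p. u p + v p) \<le> L2_set (\<lambda>p. norm (u p) + norm (v p)) {..<m}"
    unfolding tnorm_L2_set by (intro L2_set_mono norm_triangle_ineq) auto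
  also have "\<dots> \<le> tnorm m u + tnorm m v" unfolding tnorm_L2_set by (rule L2_set_triangle_ineq)
  finally show ?thesis .
qed

lemma tnorm_sum: "tnorm m (\<lambda>p. \<Sum>i\<in>I. f i p) \<le> (\<Sum>i\<in>I. tnorm m (f i))"
proof (induction I rule: infinite_finite_induct)
  case (insert x F)
  then show ?case using tnorm_triangle[of m "f x" "\<lambda>p. \<Sum>i\<in>F. f i p"] by simp
qed auto

lemma tnorm_bound:
  assumes "\<And>p. p < m \<Longrightarrow> norm (u p) \<le> B * norm (v p)" "0 \<le> B"
  shows "tnorm m u \<le> B * tnorm m v"
proof -
  have "tnorm m u \<le> L2_set (\<lambda>p. B * norm (v p)) {..<m}"
    unfolding tnorm_L2_set by (intro L2_set_mono) (use assms in auto)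
  also have "\<dots> = B * tnorm m v" unfolding tnorm_L2_set using assms(2)
    by (simp add: L2_set_right_distrib)
  finally show ?thesis .
qed

lemma norm_le_tnorm: "p < m \<Longrightarrow> norm (v p) \<le> tnorm m v"
  unfolding tnorm_L2_set by (rule member_le_L2_set) auto

lemma tens_outside: "v \<in> tens m S \<Longrightarrow> m \<le> p \<Longrightarrow> v p = 0"
  by (simp add: tens_def)

lemma tens_eqI:
  assumes "u \<in> tens m S" "v \<in> tens m S" "\<And>p. p < m \<Longrightarrow> u p = v p"
  shows "u = v"
proof
  fix p
  show "u p = v p"
    using assms(3)[of p] tens_outside[OF assms(1), of p] tens_outside[OF assms(2), of p]
    by (cases "p < m") auto
qed

lemma tnorm_eq_0:
  assumes "v \<in> tens m S" "tnorm m v = 0"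
  shows "v = (\<lambda>p. 0)"
proof
  fix p
  show "v p = 0"
    using norm_le_tnorm[of p m v] assms(2) tens_outside[OF assms(1), of p] by (cases "p < m") auto
qed

lemma tens_diff: "csubspace S \<Longrightarrow> u \<in> tens m S \<Longrightarrow> v \<in> tens m S \<Longrightarrow> (\<lambda>p. u p - v p) \<in> tens m S"
  by (auto simp: tens_def csubspace_diff)

lemma tendsto_tnorm_zero:
  assumes "\<And>p. p < m \<Longrightarrow> (\<lambda>i. f i p) \<longlonglongrightarrow> 0"
  shows "(\<lambda>i. tnorm m (f i)) \<longlonglongrightarrow> 0"
proof -
  have "(\<lambda>i. sqrt (\<Sum>p<m. (norm (f i p))\<^sup>2)) \<longlonglongrightarrow> sqrt (\<Sum>p<m. (norm (0::'a))\<^sup>2)"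
    by (intro tendsto_intros assms) auto
  then show ?thesis by (simp add: tnorm_def)
qed

section \<open>Lower bounds, surjectivity and their stability\<close>

definition tens_op :: "nat \<Rightarrow> 'a::chilbert_space set \<Rightarrow> ((nat \<Rightarrow> 'a) \<Rightarrow> nat \<Rightarrow> 'a) \<Rightarrow> bool" where
  "tens_op m S L \<longleftrightarrow> L ` tens m S \<subseteq> tens m S \<and>
     (\<forall>u\<in>tens m S. \<forall>v\<in>tens m S. L (\<lambda>p. u p - v p) = (\<lambda>p. L u p - L v p)) \<and>
     (\<exists>B. \<forall>v\<in>tens m S. tnorm m (L v) \<le> B * tnorm m v)"

text \<open>Quantitative injectivity. A smaller subspace inherits it with the same constant.\<close>

definition bdd_below_by :: "real \<Rightarrow> nat \<Rightarrow> 'a::chilbert_space set \<Rightarrow> ((nat \<Rightarrow> 'a) \<Rightarrow> nat \<Rightarrow> 'a) \<Rightarrow> bool" where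
  "bdd_below_by k m S L \<longleftrightarrow> 0 < k \<and> (\<forall>v\<in>tens m S. k * tnorm m v \<le> tnorm m (L v))"

lemma bdd_below_by_inj:
  assumes cs: "csubspace S" and op: "tens_op m S L" and b: "bdd_below_by k m S L"
  shows "inj_on L (tens m S)"
proof (rule inj_onI)
  fix u v assume uv: "u \<in> tens m S" "v \<in> tens m S" "L u = L v"
  define w where "w = (\<lambda>p. u p - v p)"
  have w: "w \<in> tens m S" unfolding w_def by (intro tens_diff cs uv)
  have "L w = (\<lambda>p. L u p - L v p)" unfolding w_def using op uv by (simp add: tens_op_def)
  then have "tnorm m (L w) = 0" using uv by simp
  then have "k * tnorm m w \<le> 0" "0 < k" using b w by (metis bdd_below_by_def)+
  then have "tnorm m w = 0" using tnorm_nonneg[of m w] by (simp add: mult_le_0_iff)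
  then have "w = (\<lambda>p. 0)" using tnorm_eq_0[OF w] by blast
  then show "u = v" unfolding w_def by (metis eq_iff_diff_eq_0 ext)
qed

text \<open>A bound on the inverse is the same as a lower bound on \<open>L\<close>. The equivalence
  separates the half of invertibility that restricts to subspaces from the half that must be proved
  anew there.\<close>

lemma inv_op_iff:
  assumes cs: "csubspace S" and op: "tens_op m S L"
  shows "inv_op m S L \<longleftrightarrow> (\<exists>k. bdd_below_by k m S L) \<and> tens m S \<subseteq> L ` tens m S"
proof
  assume "inv_op m S L"
  then obtain R K where R: "\<And>v. v \<in> tens m S \<Longrightarrow> R v \<in> tens m S \<and> R (L v) = v \<and> L (R v) = v"
    and K: "\<And>v. v \<in> tens m S \<Longrightarrow> tnorm m (R v) \<le> K * tnorm m v"
    unfolding inv_op_def by blast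
  \<comment> \<open>The constant \<open>K\<close> may be zero or negative when the space is trivial;
    the absolute value plus one keeps \<open>k\<close> positive.\<close>
  define k where "k = 1 / (\<bar>K\<bar> + 1)"
  have "k * tnorm m v \<le> tnorm m (L v)" if v: "v \<in> tens m S" for v
  proof -
    have "L v \<in> tens m S" using op v by (auto simp: tens_op_def)
    then have "tnorm m v \<le> K * tnorm m (L v)" using K[of "L v"] R[OF v] by simp
    also have "\<dots> \<le> (\<bar>K\<bar> + 1) * tnorm m (L v)" by (intro mult_right_mono) auto
    finally show ?thesis by (simp add: k_def field_simps)
  qed
  moreover have "0 < k" by (simp add: k_def add_nonneg_pos)
  ultimately have "bdd_below_by k m S L" by (simp add: bdd_below_by_def)
  moreover have "tens m S \<subseteq> L ` tens m S"
  proof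
    fix v assume "v \<in> tens m S"
    then show "v \<in> L ` tens m S" using R[of v] by (intro image_eqI[of _ _ "R v"]) auto
  qed
  ultimately show "(\<exists>k. bdd_below_by k m S L) \<and> tens m S \<subseteq> L ` tens m S" by blast
next
  assume "(\<exists>k. bdd_below_by k m S L) \<and> tens m S \<subseteq> L ` tens m S"
  then obtain k where k: "bdd_below_by k m S L" and surj: "tens m S \<subseteq> L ` tens m S" by blast
  have inj: "inj_on L (tens m S)" by (rule bdd_below_by_inj[OF cs op k])
  define R where "R = the_inv_into (tens m S) L"
  have R: "R v \<in> tens m S" "L (R v) = v" if "v \<in> tens m S" for v
    using the_inv_into_into[OF inj, of v "tens m S"] f_the_inv_into_f[OF inj, of v] surj that
    by (auto simp: R_def)
  have RL: "R (L v) = v" if "v \<in> tens m S" for v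
    unfolding R_def by (rule the_inv_into_f_f[OF inj that])
  have "tnorm m (R v) \<le> (1 / k) * tnorm m v" if v: "v \<in> tens m S" for v
  proof -
    have "k * tnorm m (R v) \<le> tnorm m (L (R v))" "0 < k"
      using k R(1)[OF v] by (auto simp: bdd_below_by_def)
    then show ?thesis using R(2)[OF v] by (simp add: field_simps)
  qed
  then show "inv_op m S L" unfolding inv_op_def using R RL by blast
qed

lemma perturb_bdd_below:
  assumes "bdd_below_by k m S L" and "\<epsilon> < k"
    and close: "\<And>v. v \<in> tens m S \<Longrightarrow> tnorm m (\<lambda>p. L v p - L' v p) \<le> \<epsilon> * tnorm m v"
  shows "bdd_below_by (k - \<epsilon>) m S L'"
  unfolding bdd_below_by_def
proof (intro conjI ballI)
  fix v assume v: "v \<in> tens m S"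
  have "k * tnorm m v \<le> tnorm m (\<lambda>p. (L v p - L' v p) + L' v p)"
    using assms(1) v by (simp add: bdd_below_by_def)
  also have "\<dots> \<le> tnorm m (\<lambda>p. L v p - L' v p) + tnorm m (L' v)" by (rule tnorm_triangle)
  also have "\<dots> \<le> \<epsilon> * tnorm m v + tnorm m (L' v)" using close[OF v] by simp
  finally show "(k - \<epsilon>) * tnorm m v \<le> tnorm m (L' v)" by (simp add: algebra_simps)
qed (use assms in simp)

text \<open>Choose preimages \<open>R\<close> under \<open>L\<close>; they are bounded by
  \<open>1 / k\<close>. One correction by \<open>R\<close> replaces a residual \<open>x\<close> by
  \<open>L (R x) - L' (R x)\<close>, which is shorter by the factor
  \<open>\<epsilon> / k < 1\<close>. The corrections therefore sum to an exact solution for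
  \<open>L'\<close>. Linearity enters only on the side of \<open>L'\<close>; \<open>R\<close> is a
  bare choice function.\<close>

lemma perturb_surj:
  fixes S :: "'a::chilbert_space set"
  assumes S: "closed_csubspace S" and op': "tens_op m S L'"
    and b: "bdd_below_by k m S L" and surj: "tens m S \<subseteq> L ` tens m S"
    and eps: "0 \<le> \<epsilon>" "\<epsilon> < k"
    and close: "\<And>v. v \<in> tens m S \<Longrightarrow> tnorm m (\<lambda>p. L v p - L' v p) \<le> \<epsilon> * tnorm m v"
  shows "tens m S \<subseteq> L' ` tens m S"
proof
  fix w assume w: "w \<in> tens m S"
  have cs: "csubspace S" and cl: "closed S" using S by (auto simp: closed_csubspace_def)
  have k: "0 < k" using b by (simp add: bdd_below_by_def)
  define R where "R = inv_into (tens m S) L"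
  have R: "R v \<in> tens m S" "L (R v) = v" if "v \<in> tens m S" for v
    using inv_into_into[of v L "tens m S"] f_inv_into_f[of v L "tens m S"] surj that
    by (auto simp: R_def)
  have R_bound: "tnorm m (R v) \<le> tnorm m v / k" if "v \<in> tens m S" for v
    using b R[OF that] k by (auto simp: bdd_below_by_def field_simps)
  have L'_in: "L' v \<in> tens m S" if "v \<in> tens m S" for v using op' that by (auto simp: tens_op_def)
  have L'_diff: "L' (\<lambda>p. u p - v p) = (\<lambda>p. L' u p - L' v p)" if "u \<in> tens m S" "v \<in> tens m S" for u v
    using op' that by (simp add: tens_op_def)
  \<comment> \<open>\<open>r i\<close> is the residual after \<open>i\<close> terms of the Neumann series, \<open>s i\<close> the partial sum.\<close>
  define r where "r = rec_nat w (\<lambda>i x p. x p - L' (R x) p)"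
  define s where "s i p = (\<Sum>l<i. R (r l) p)" for i p
  have r_0: "r 0 = w" and r_Suc: "r (Suc i) = (\<lambda>p. r i p - L' (R (r i)) p)" for i
    by (simp_all add: r_def)
  have r_in: "r i \<in> tens m S" for i
  proof (induction i)
    case (Suc i)
    then show ?case unfolding r_Suc by (intro tens_diff cs L'_in R)
  qed (simp add: r_0 w)
  have r_bound: "tnorm m (r i) \<le> (\<epsilon> / k) ^ i * tnorm m w" for i
  proof (induction i)
    case (Suc i)
    have "tnorm m (r (Suc i)) \<le> \<epsilon> * tnorm m (R (r i))"
      unfolding r_Suc using close[OF R(1)[OF r_in]] R(2)[OF r_in] by simp
    also have "\<dots> \<le> \<epsilon> * (tnorm m (r i) / k)" by (intro mult_left_mono R_bound r_in eps)
    also have "\<dots> = (\<epsilon> / k) * tnorm m (r i)" by simp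
    also have "\<dots> \<le> (\<epsilon> / k) * ((\<epsilon> / k) ^ i * tnorm m w)"
      using Suc eps k by (intro mult_left_mono) auto
    finally show ?case by (simp add: mult_ac)
  qed (simp add: r_0)
  have q: "0 \<le> \<epsilon> / k" "\<epsilon> / k < 1" using eps k by auto
  have term_bound: "norm (R (r i) p) \<le> (\<epsilon> / k) ^ i * (tnorm m w / k)" for i p
  proof (cases "p < m")
    case True
    have "norm (R (r i) p) \<le> tnorm m (r i) / k"
      using norm_le_tnorm[OF True] R_bound[OF r_in] by (rule order_trans)
    also have "\<dots> \<le> (\<epsilon> / k) ^ i * tnorm m w / k" using r_bound k by (intro divide_right_mono) auto
    finally show ?thesis by simp
  next
    case False
    then have "R (r i) p = 0" using R(1)[OF r_in] by (auto simp: tens_def)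
    then show ?thesis using q k by simp
  qed
  define v where "v p = (\<Sum>l. R (r l) p)" for p
  have "summable (\<lambda>l. R (r l) p)" for p
  proof (rule summable_comparison_test')
    show "summable (\<lambda>i. (\<epsilon> / k) ^ i * (tnorm m w / k))"
      using q by (intro summable_mult2 summable_geometric) simp
  qed (rule term_bound)
  then have lim: "(\<lambda>i. s i p) \<longlonglongrightarrow> v p" for p
    unfolding v_def s_def by (rule summable_LIMSEQ)
  have s_in: "s i \<in> tens m S" for i
    using R(1)[OF r_in] unfolding tens_def s_def by (auto intro!: csubspace_sum[OF cs])
  have "v p \<in> S" if "p < m" for p
    using closed_sequentially[OF cl _ lim[of p]] s_in that by (auto simp: tens_def)
  moreover have "v p = 0" if "p \<ge> m" for p
    using R(1)[OF r_in] that by (simp add: v_def tens_def)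
  ultimately have v_in: "v \<in> tens m S" by (simp add: tens_def)
  have L's: "L' (s i) p = w p - r i p" for i p
  proof (induction i)
    case 0
    \<comment> \<open>\<open>tens_op\<close> speaks of differences, so the value of
      \<open>L'\<close> at zero is obtained from \<open>w - w\<close>.\<close>
    have "s 0 = (\<lambda>p. w p - w p)" by (simp add: s_def fun_eq_iff)
    then have "L' (s 0) = (\<lambda>p. L' w p - L' w p)" using L'_diff[OF w w] by simp
    then show ?case by (simp add: r_0)
  next
    case (Suc i)
    have "R (r i) = (\<lambda>p. s (Suc i) p - s i p)" by (simp add: s_def)
    then have "L' (R (r i)) = (\<lambda>p. L' (s (Suc i)) p - L' (s i) p)" using L'_diff[OF s_in s_in] by simp
    then have "L' (s (Suc i)) p = L' (R (r i)) p + L' (s i) p" by simp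
    then show ?case using Suc by (simp add: r_Suc)
  qed
  obtain B where B: "\<And>v. v \<in> tens m S \<Longrightarrow> tnorm m (L' v) \<le> B * tnorm m v"
    using op' unfolding tens_op_def by blast
  have "L' v p = w p" if p: "p < m" for p
  proof -
    \<comment> \<open>Coordinatewise convergence of the partial sums gives convergence in
      \<open>tnorm\<close>, as there are only \<open>m\<close> coordinates. Two limits of
      \<open>L' (s i) p\<close> are then compared: one from boundedness of \<open>L'\<close>, one
      from the vanishing residual.\<close>
    have "(\<lambda>i. tnorm m (\<lambda>p. s i p - v p)) \<longlonglongrightarrow> 0"
      by (intro tendsto_tnorm_zero LIM_zero lim)
    then have g: "(\<lambda>i. B * tnorm m (\<lambda>p. s i p - v p)) \<longlonglongrightarrow> 0" by (rule tendsto_mult_right_zero)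
    have fg: "norm (L' (s i) p - L' v p) \<le> B * tnorm m (\<lambda>p. s i p - v p)" for i
      using norm_le_tnorm[OF p, of "L' (\<lambda>p. s i p - v p)"] B[OF tens_diff[OF cs s_in[of i] v_in]]
      by (simp add: L'_diff[OF s_in v_in])
    have "(\<lambda>i. L' (s i) p - L' v p) \<longlonglongrightarrow> 0"
      by (rule Lim_null_comparison[OF always_eventually[OF allI[OF fg]] g])
    then have 1: "(\<lambda>i. L' (s i) p) \<longlonglongrightarrow> L' v p" by (rule LIM_zero_cancel)
    have g': "(\<lambda>i. (\<epsilon> / k) ^ i * tnorm m w) \<longlonglongrightarrow> 0"
      using q by (intro tendsto_mult_left_zero LIMSEQ_realpow_zero) auto
    have fg': "norm (r i p) \<le> (\<epsilon> / k) ^ i * tnorm m w" for i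
      using norm_le_tnorm[OF p] r_bound by (rule order_trans)
    have "(\<lambda>i. r i p) \<longlonglongrightarrow> 0"
      by (rule Lim_null_comparison[OF always_eventually[OF allI[OF fg']] g'])
    then have "(\<lambda>i. w p - r i p) \<longlonglongrightarrow> w p - 0" by (intro tendsto_intros)
    then have "(\<lambda>i. L' (s i) p) \<longlonglongrightarrow> w p" by (simp add: L's)
    with 1 show ?thesis by (rule LIMSEQ_unique)
  qed
  then have "w = L' v" by (intro tens_eqI[OF w L'_in[OF v_in]]) simp
  then show "w \<in> L' ` tens m S" using v_in by blast
qed

section \<open>The pencil \<open>L_A\<close>\<close>

lemma orthogonal_expansion:
  fixes v :: "nat \<Rightarrow> 'a::complex_inner"
  obtains e a where "\<And>p. p < m \<Longrightarrow> v p = (\<Sum>l<m. a p l *\<^sub>C e l)"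
    and "\<And>l l'. l < m \<Longrightarrow> l' < m \<Longrightarrow> l \<noteq> l' \<Longrightarrow> cinner (e l) (e l') = 0"
proof -
  have "\<exists>e a. (\<forall>p<m. v p = (\<Sum>l<m. a p l *\<^sub>C e l)) \<and>
      (\<forall>l<m. \<forall>l'<m. l \<noteq> l' \<longrightarrow> cinner (e l) (e l') = 0)"
  proof (induction m)
    case (Suc m)
    then obtain e a where ea: "\<And>p. p < m \<Longrightarrow> v p = (\<Sum>l<m. a p l *\<^sub>C e l)"
      and orth: "\<And>l l'. l < m \<Longrightarrow> l' < m \<Longrightarrow> l \<noteq> l' \<Longrightarrow> cinner (e l) (e l') = 0"
      by blast
    \<comment> \<open>Unnormalised Gram--Schmidt; \<open>x / 0 = 0\<close> takes care of vanishing \<open>e l\<close>.\<close>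
    define c where "c l = cinner (e l) (v m) / cinner (e l) (e l)" for l
    define em where "em = v m - (\<Sum>l<m. c l *\<^sub>C e l)"
    define e' where "e' = e(m := em)"
    \<comment> \<open>Old rows get a zero in the new column \<open>m\<close>; the new row consists
      of the coefficients \<open>c l\<close> and a final 1 in front of \<open>em\<close>.\<close>
    define a' where "a' p l = (if p < m then (if l < m then a p l else 0) else (if l < m then c l else 1))"
      for p l
    have em_orth: "cinner (e l) em = 0" if l: "l < m" for l
    proof -
      have "cinner (e l) (\<Sum>l'<m. c l' *\<^sub>C e l') = (\<Sum>l'<m. if l' = l then c l * cinner (e l) (e l) else 0)"
        unfolding cinner_sum_right by (intro sum.cong) (auto simp: cinner_scaleC_right orth l)
      also have "\<dots> = c l * cinner (e l) (e l)" using l by simp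
      also have "\<dots> = cinner (e l) (v m)"
        by (cases "e l = 0") (simp_all add: c_def cinner_eq_zero_iff)
      finally show ?thesis by (simp add: em_def cinner_diff_right)
    qed
    then have em_orth': "cinner em (e l) = 0" if "l < m" for l
      using that cinner_commute[of em "e l"] by simp
    have "v p = (\<Sum>l<Suc m. a' p l *\<^sub>C e' l)" if p: "p < Suc m" for p
    proof (cases "p < m")
      case True
      then show ?thesis using ea[OF True] by (simp add: a'_def e'_def)
    next
      case False
      then have "p = m" using p by simp
      then show ?thesis by (simp add: a'_def e'_def em_def)
    qed
    moreover have "cinner (e' l) (e' l') = 0" if "l < Suc m" "l' < Suc m" "l \<noteq> l'" for l l'
      using that by (auto simp: e'_def em_orth em_orth' orth less_Suc_eq)
    ultimately show ?case by blast
  qed simp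
  then show thesis using that by blast
qed

lemma norm_orthogonal_sum:
  fixes e :: "nat \<Rightarrow> 'a::complex_inner"
  assumes "\<And>l l'. l < m \<Longrightarrow> l' < m \<Longrightarrow> l \<noteq> l' \<Longrightarrow> cinner (e l) (e l') = 0"
  shows "(norm (\<Sum>l<m. c l *\<^sub>C e l))\<^sup>2 = (\<Sum>l<m. (cmod (c l))\<^sup>2 * (norm (e l))\<^sup>2)"
  using assms
proof (induction m)
  case (Suc m)
  have "cinner (\<Sum>l<m. c l *\<^sub>C e l) (c m *\<^sub>C e m) = 0"
    unfolding cinner_sum_left by (intro sum.neutral) (simp add: cinner_scaleC_left cinner_scaleC_right Suc.prems)
  then have "(norm (\<Sum>l<Suc m. c l *\<^sub>C e l))\<^sup>2 = (norm (\<Sum>l<m. c l *\<^sub>C e l))\<^sup>2 + (norm (c m *\<^sub>C e m))\<^sup>2"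
    unfolding sum.lessThan_Suc by (rule pythagoras)
  then show ?case using Suc.IH Suc.prems by (simp add: power_mult_distrib)
qed simp

text \<open>Expanding \<open>v\<close> along orthogonal directions \<open>e l\<close> turns both
  squared norms into sums over \<open>l\<close> weighted by the squared norm of \<open>e l\<close>.
  The scalar bound applies to each coefficient column, so the norm of \<open>B\<close> tensored with
  the identity is at most that of \<open>B\<close>.\<close>

lemma scalar_matrix_tensor_bound:
  fixes v :: "nat \<Rightarrow> 'a::chilbert_space"
  assumes B: "\<And>x. (\<Sum>p<m. (cmod (\<Sum>q<m. B p q * x q))\<^sup>2) \<le> \<beta>\<^sup>2 * (\<Sum>q<m. (cmod (x q))\<^sup>2)" and "0 \<le> \<beta>"
  shows "tnorm m (\<lambda>p. \<Sum>q<m. B p q *\<^sub>C v q) \<le> \<beta> * tnorm m v"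
proof -
  obtain e a where ea: "\<And>p. p < m \<Longrightarrow> v p = (\<Sum>l<m. a p l *\<^sub>C e l)"
    and orth: "\<And>l l'. l < m \<Longrightarrow> l' < m \<Longrightarrow> l \<noteq> l' \<Longrightarrow> cinner (e l) (e l') = 0"
    by (rule orthogonal_expansion[of m v]) (rule that)
  have nos: "(norm (\<Sum>l<m. c l *\<^sub>C e l))\<^sup>2 = (\<Sum>l<m. (cmod (c l))\<^sup>2 * (norm (e l))\<^sup>2)" for c
    by (intro norm_orthogonal_sum orth)
  have "(norm (\<Sum>q<m. B p q *\<^sub>C v q))\<^sup>2 = (\<Sum>l<m. (cmod (\<Sum>q<m. B p q * a q l))\<^sup>2 * (norm (e l))\<^sup>2)" for p
  proof -
    have "(\<Sum>q<m. B p q *\<^sub>C v q) = (\<Sum>q<m. \<Sum>l<m. (B p q * a q l) *\<^sub>C e l)"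
      by (intro sum.cong) (auto simp: ea scaleC_sum_right scaleC_scaleC)
    also have "\<dots> = (\<Sum>l<m. (\<Sum>q<m. B p q * a q l) *\<^sub>C e l)"
      unfolding scaleC_sum_left by (rule sum.swap)
    finally show ?thesis by (simp only: nos)
  qed
  then have "(\<Sum>p<m. (norm (\<Sum>q<m. B p q *\<^sub>C v q))\<^sup>2)
      = (\<Sum>l<m. (\<Sum>p<m. (cmod (\<Sum>q<m. B p q * a q l))\<^sup>2) * (norm (e l))\<^sup>2)"
    by (simp add: sum_distrib_right) (rule sum.swap)
  also have "\<dots> \<le> (\<Sum>l<m. (\<beta>\<^sup>2 * (\<Sum>q<m. (cmod (a q l))\<^sup>2)) * (norm (e l))\<^sup>2)"
    by (intro sum_mono mult_right_mono B) simp
  also have "\<dots> = \<beta>\<^sup>2 * (\<Sum>l<m. \<Sum>q<m. (cmod (a q l))\<^sup>2 * (norm (e l))\<^sup>2)"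
    by (simp add: sum_distrib_left sum_distrib_right mult.assoc)
  also have "(\<Sum>l<m. \<Sum>q<m. (cmod (a q l))\<^sup>2 * (norm (e l))\<^sup>2)
      = (\<Sum>q<m. \<Sum>l<m. (cmod (a q l))\<^sup>2 * (norm (e l))\<^sup>2)"
    by (rule sum.swap)
  also have "(\<Sum>q<m. \<Sum>l<m. (cmod (a q l))\<^sup>2 * (norm (e l))\<^sup>2) = (\<Sum>q<m. (norm (v q))\<^sup>2)"
    by (intro sum.cong) (auto simp: ea nos)
  finally have "sqrt (\<Sum>p<m. (norm (\<Sum>q<m. B p q *\<^sub>C v q))\<^sup>2) \<le> sqrt (\<beta>\<^sup>2 * (\<Sum>q<m. (norm (v q))\<^sup>2))"
    by (rule real_sqrt_le_mono)
  then show ?thesis using \<open>0 \<le> \<beta>\<close> by (simp add: tnorm_def real_sqrt_mult)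
qed

section \<open>Block indices and operator bounds for matrices\<close>

lemma block_index_less:
  assumes "p < m" "i < n"
  shows "p * n + i < m * (n::nat)"
proof -
  have "p * n + i < Suc p * n" using assms by simp
  also have "\<dots> \<le> m * n" by (rule mult_le_mono1) (use assms in simp)
  finally show ?thesis .
qed

text \<open>The indices congruent to \<open>k\<close> are the \<open>k\<close>-th slots of the
  \<open>m\<close> blocks; the lemma turns sums over all \<open>m * n\<close> coordinates into sums
  over blocks.\<close>

lemma sum_residue_class:
  fixes f :: "nat \<Rightarrow> 'b::comm_monoid_add"
  assumes k: "k < n" and f: "\<And>t. t < m * n \<Longrightarrow> t mod n \<noteq> k \<Longrightarrow> f t = 0"
  shows "(\<Sum>t<m * n. f t) = (\<Sum>q<m. f (q * n + k))"
proof -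
  have "(\<Sum>q<m. f (q * n + k)) = sum f ((\<lambda>q. q * n + k) ` {..<m})"
    using k by (subst sum.reindex) (auto simp: inj_on_def)
  also have "\<dots> = (\<Sum>t<m * n. f t)"
  proof (rule sum.mono_neutral_left)
    show "(\<lambda>q. q * n + k) ` {..<m} \<subseteq> {..<m * n}" using k block_index_less by auto
    show "\<forall>t\<in>{..<m * n} - (\<lambda>q. q * n + k) ` {..<m}. f t = 0"
    proof
      fix t assume t: "t \<in> {..<m * n} - (\<lambda>q. q * n + k) ` {..<m}"
      have "t mod n \<noteq> k"
      proof
        assume "t mod n = k"
        then have "t = (t div n) * n + k" by (metis div_mult_mod_eq)
        moreover have "t div n < m" using t by (simp add: less_mult_imp_div_less)
        ultimately show False using t by blast
      qed
      then show "f t = 0" using f t by simp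
    qed
  qed simp
  finally show ?thesis by simp
qed

lemma vnorm_nonneg [simp]: "0 \<le> vnorm v"
  by (simp add: vnorm_def sum_nonneg)

lemma vnorm_sq: "(vnorm v)\<^sup>2 = (\<Sum>i<dim_vec v. (cmod (v $ i))\<^sup>2)"
  by (simp add: vnorm_def sum_nonneg)

lemma cmod_le_vnorm: "i < dim_vec v \<Longrightarrow> cmod (v $ i) \<le> vnorm v"
  unfolding vnorm_def using member_le_L2_set[of "{..<dim_vec v}" i "\<lambda>i. cmod (v $ i)"]
  by (simp add: L2_set_def)

text \<open>A bound on the operator norm is kept as a relation, so that \<open>colnorm\<close> and
  the crude sum of entries can both serve as \<open>\<beta>\<close>.\<close>

definition mat_bounded :: "nat \<Rightarrow> complex mat \<Rightarrow> real \<Rightarrow> bool" where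
  "mat_bounded N Z \<beta> \<longleftrightarrow> 0 \<le> \<beta> \<and> Z \<in> carrier_mat N N \<and>
     (\<forall>x\<in>carrier_vec N. vnorm (Z *\<^sub>v x) \<le> \<beta> * vnorm x)"

lemma mult_mat_vec_nth:
  "Z \<in> carrier_mat N N \<Longrightarrow> x \<in> carrier_vec N \<Longrightarrow> t < N \<Longrightarrow> (Z *\<^sub>v x) $ t = (\<Sum>l<N. Z $$ (t, l) * x $ l)"
  by (auto simp: scalar_prod_def lessThan_atLeast0 intro!: sum.cong)

text \<open>This bound can grow with the size of the matrix; it suffices where the size is fixed, as
  for boundedness of \<open>LA\<close> and for continuity along a path.\<close>

lemma mat_bounded_entries:
  assumes Z: "Z \<in> carrier_mat N N"
  shows "mat_bounded N Z (\<Sum>i<N. \<Sum>l<N. cmod (Z $$ (i, l)))"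
  unfolding mat_bounded_def
proof (intro conjI ballI Z)
  fix x :: "complex Matrix.vec" assume x: "x \<in> carrier_vec N"
  have "vnorm (Z *\<^sub>v x) \<le> (\<Sum>i<N. cmod ((Z *\<^sub>v x) $ i))"
    using L2_set_le_sum[of "{..<N}" "\<lambda>i. cmod ((Z *\<^sub>v x) $ i)"] Z by (simp add: vnorm_def L2_set_def)
  also have "\<dots> \<le> (\<Sum>i<N. \<Sum>l<N. cmod (Z $$ (i, l)) * vnorm x)"
  proof (rule sum_mono)
    fix i assume "i \<in> {..<N}"
    then have "cmod ((Z *\<^sub>v x) $ i) \<le> (\<Sum>l<N. cmod (Z $$ (i, l) * x $ l))"
      using mult_mat_vec_nth[OF Z x] norm_sum by simp
    also have "\<dots> \<le> (\<Sum>l<N. cmod (Z $$ (i, l)) * vnorm x)"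
      using x by (intro sum_mono) (auto simp: norm_mult intro!: mult_left_mono cmod_le_vnorm)
    finally show "cmod ((Z *\<^sub>v x) $ i) \<le> (\<Sum>l<N. cmod (Z $$ (i, l)) * vnorm x)" .
  qed
  finally show "vnorm (Z *\<^sub>v x) \<le> (\<Sum>i<N. \<Sum>l<N. cmod (Z $$ (i, l))) * vnorm x"
    by (simp add: sum_distrib_right)
qed (simp add: sum_nonneg)

lemma mat_bounded_mono:
  assumes Z: "mat_bounded N Z \<beta>" and "\<beta> \<le> \<gamma>"
  shows "mat_bounded N Z \<gamma>"
  unfolding mat_bounded_def
proof (intro conjI ballI)
  fix x :: "complex Matrix.vec" assume "x \<in> carrier_vec N"
  then have "vnorm (Z *\<^sub>v x) \<le> \<beta> * vnorm x" using Z by (simp add: mat_bounded_def)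
  also have "\<dots> \<le> \<gamma> * vnorm x" by (intro mult_right_mono assms) simp
  finally show "vnorm (Z *\<^sub>v x) \<le> \<gamma> * vnorm x" .
qed (use assms in \<open>auto simp: mat_bounded_def\<close>)

text \<open>Entry \<open>(i, k)\<close> of every block, collected into an \<open>m\<close> by
  \<open>m\<close> matrix, is a compression of \<open>Z\<close>: scalars are embedded isometrically
  into the \<open>k\<close>-th slots, \<open>Z\<close> is applied, and only the \<open>i\<close>-th
  slots are read off. Hence the bound of \<open>Z\<close> survives without a loss in
  \<open>m\<close>.\<close>

lemma mat_bounded_block:
  fixes v :: "nat \<Rightarrow> 'a::chilbert_space"
  assumes Z: "mat_bounded (m * n) Z \<beta>" and ik: "i < n" "k < n"
  shows "tnorm m (\<lambda>p. \<Sum>q<m. Z $$ (p * n + i, q * n + k) *\<^sub>C v q) \<le> \<beta> * tnorm m v"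
proof (rule scalar_matrix_tensor_bound)
  have \<beta>: "0 \<le> \<beta>" and Zc: "Z \<in> carrier_mat (m * n) (m * n)" using Z by (auto simp: mat_bounded_def)
  show "0 \<le> \<beta>" by fact
  fix x :: "nat \<Rightarrow> complex"
  \<comment> \<open>The isometric embedding: \<open>x q\<close> stands in slot \<open>k\<close> of
    block \<open>q\<close>, all other slots vanish.\<close>
  define y where "y = Matrix.vec (m * n) (\<lambda>t. if t mod n = k then x (t div n) else 0)"
  have y: "y \<in> carrier_vec (m * n)" by (simp add: y_def)
  have yn: "y $ (q * n + k) = x q" if "q < m" for q
    using that ik by (simp add: y_def block_index_less)
  have y0: "y $ t = 0" if "t < m * n" "t mod n \<noteq> k" for t
    using that by (simp add: y_def)
  have Zy: "(Z *\<^sub>v y) $ (p * n + i) = (\<Sum>q<m. Z $$ (p * n + i, q * n + k) * x q)" if p: "p < m" for p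
  proof -
    have "(Z *\<^sub>v y) $ (p * n + i) = (\<Sum>l<m * n. Z $$ (p * n + i, l) * y $ l)"
      by (intro mult_mat_vec_nth Zc y block_index_less p ik)
    also have "\<dots> = (\<Sum>q<m. Z $$ (p * n + i, q * n + k) * y $ (q * n + k))"
      by (intro sum_residue_class ik) (simp add: y0)
    finally show ?thesis by (simp add: yn)
  qed
  have "(\<Sum>p<m. (cmod (\<Sum>q<m. Z $$ (p * n + i, q * n + k) * x q))\<^sup>2)
      = (\<Sum>p<m. (cmod ((Z *\<^sub>v y) $ (p * n + i)))\<^sup>2)"
    by (intro sum.cong) (auto simp: Zy)
  also have "\<dots> = sum (\<lambda>t. (cmod ((Z *\<^sub>v y) $ t))\<^sup>2) ((\<lambda>p. p * n + i) ` {..<m})"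
    using ik by (subst sum.reindex) (auto simp: inj_on_def)
  also have "\<dots> \<le> (\<Sum>t<m * n. (cmod ((Z *\<^sub>v y) $ t))\<^sup>2)"
    using ik by (intro sum_mono2) (auto simp: block_index_less)
  also have "\<dots> = (vnorm (Z *\<^sub>v y))\<^sup>2" using Zc by (simp add: vnorm_sq)
  also have "\<dots> \<le> (\<beta> * vnorm y)\<^sup>2" using Z y by (intro power_mono) (auto simp: mat_bounded_def)
  also have "\<dots> = \<beta>\<^sup>2 * (\<Sum>t<m * n. (cmod (y $ t))\<^sup>2)" using y by (simp add: power_mult_distrib vnorm_sq)
  also have "(\<Sum>t<m * n. (cmod (y $ t))\<^sup>2) = (\<Sum>q<m. (cmod (y $ (q * n + k)))\<^sup>2)"
    by (intro sum_residue_class ik) (simp add: y0)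
  finally show "(\<Sum>p<m. (cmod (\<Sum>q<m. Z $$ (p * n + i, q * n + k) * x q))\<^sup>2) \<le> \<beta>\<^sup>2 * (\<Sum>q<m. (cmod (x q))\<^sup>2)"
    by (simp add: yn)
qed

section \<open>Linear families of bounded operators and the bound for the pencil\<close>

definition op_family :: "'a::chilbert_space set \<Rightarrow> nat \<Rightarrow> nat \<Rightarrow> (nat \<Rightarrow> complex mat \<Rightarrow> 'a \<Rightarrow> 'a) \<Rightarrow> bool" where
  "op_family S n d A \<longleftrightarrow> closed_csubspace S \<and>
     (\<forall>j<d. (\<forall>G\<in>carrier_mat n n. bop S (A j G)) \<and>
        (\<forall>G\<in>carrier_mat n n. \<forall>H\<in>carrier_mat n n. \<forall>x\<in>S. A j (G + H) x = A j G x + A j H x) \<and>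
        (\<forall>a. \<forall>G\<in>carrier_mat n n. \<forall>x\<in>S. A j (a \<cdot>\<^sub>m G) x = a *\<^sub>C A j G x))"

definition mat_unit :: "nat \<Rightarrow> nat \<times> nat \<Rightarrow> complex mat" where
  "mat_unit n ik = mat n n (\<lambda>ab. if ab = ik then 1 else 0)"

lemma mat_unit_carrier [simp]: "mat_unit n ik \<in> carrier_mat n n"
  by (simp add: mat_unit_def)

context
  fixes S :: "'a::chilbert_space set" and n d :: nat and A :: "nat \<Rightarrow> complex mat \<Rightarrow> 'a \<Rightarrow> 'a"
  assumes fam: "op_family S n d A"
begin

lemma op_family_csubspace: "csubspace S"
  and op_family_in: "j < d \<Longrightarrow> G \<in> carrier_mat n n \<Longrightarrow> x \<in> S \<Longrightarrow> A j G x \<in> S"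
  and op_family_add: "j < d \<Longrightarrow> G \<in> carrier_mat n n \<Longrightarrow> x \<in> S \<Longrightarrow> y \<in> S \<Longrightarrow> A j G (x + y) = A j G x + A j G y"
  and op_family_scaleC: "j < d \<Longrightarrow> G \<in> carrier_mat n n \<Longrightarrow> x \<in> S \<Longrightarrow> A j G (a *\<^sub>C x) = a *\<^sub>C A j G x"
  and op_family_mat_add: "j < d \<Longrightarrow> G \<in> carrier_mat n n \<Longrightarrow> H \<in> carrier_mat n n \<Longrightarrow> x \<in> S \<Longrightarrow>
      A j (G + H) x = A j G x + A j H x"
  and op_family_mat_scale: "j < d \<Longrightarrow> G \<in> carrier_mat n n \<Longrightarrow> x \<in> S \<Longrightarrow> A j (a \<cdot>\<^sub>m G) x = a *\<^sub>C A j G x"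
  and op_family_bounded: "j < d \<Longrightarrow> G \<in> carrier_mat n n \<Longrightarrow> \<exists>K. \<forall>x\<in>S. norm (A j G x) \<le> K * norm x"
  using fam by (auto simp: op_family_def closed_csubspace_def bop_def image_subset_iff)

lemma op_family_zero: "j < d \<Longrightarrow> G \<in> carrier_mat n n \<Longrightarrow> A j G 0 = 0"
  using op_family_scaleC[of j G 0 0] csubspace_0[OF op_family_csubspace] by simp

lemma op_family_diff:
  "j < d \<Longrightarrow> G \<in> carrier_mat n n \<Longrightarrow> x \<in> S \<Longrightarrow> y \<in> S \<Longrightarrow> A j G (x - y) = A j G x - A j G y"
  using op_family_add[of j G "x - y" y] csubspace_diff[OF op_family_csubspace] by simp

lemma op_family_sum:
  "j < d \<Longrightarrow> G \<in> carrier_mat n n \<Longrightarrow> (\<And>i. i \<in> I \<Longrightarrow> f i \<in> S) \<Longrightarrow>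
     A j G (\<Sum>i\<in>I. f i) = (\<Sum>i\<in>I. A j G (f i))"
  by (induction I rule: infinite_finite_induct)
    (auto simp: op_family_zero op_family_add csubspace_sum[OF op_family_csubspace])

lemma op_family_mat_diff:
  assumes "j < d" "G \<in> carrier_mat n n" "H \<in> carrier_mat n n" "x \<in> S"
  shows "A j (G - H) x = A j G x - A j H x"
proof -
  have "G = (G - H) + H" using assms by (intro eq_matI) auto
  then have "A j G x = A j (G - H) x + A j H x"
    using op_family_mat_add[of j "G - H" H x] assms by (metis minus_carrier_mat)
  then show ?thesis by simp
qed

lemma op_family_mat_expand:
  assumes "j < d" "G \<in> carrier_mat n n" "x \<in> S"
  shows "A j G x = (\<Sum>ik\<in>{..<n} \<times> {..<n}. G $$ ik *\<^sub>C A j (mat_unit n ik) x)"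
proof -
  \<comment> \<open>Induction over the set \<open>I\<close> of retained entries; each new position
    contributes one scaled matrix unit.\<close>
  have part: "A j (mat n n (\<lambda>ab. if ab \<in> I then G $$ ab else 0)) x
      = (\<Sum>ik\<in>I. G $$ ik *\<^sub>C A j (mat_unit n ik) x)" if "finite I" for I
    using that
  proof (induction I)
    case empty
    have "mat n n (\<lambda>ab. if ab \<in> {} then G $$ ab else 0) = 0 \<cdot>\<^sub>m G"
      using assms(2) by (intro eq_matI) auto
    then show ?case using op_family_mat_scale[OF assms, of 0] by simp
  next
    case (insert ik I)
    have "mat n n (\<lambda>ab. if ab \<in> insert ik I then G $$ ab else 0)
        = (G $$ ik \<cdot>\<^sub>m mat_unit n ik) + mat n n (\<lambda>ab. if ab \<in> I then G $$ ab else 0)"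
      using insert(2) by (intro eq_matI) (auto simp: mat_unit_def)
    then show ?case
      using insert op_family_mat_add[OF assms(1) _ _ assms(3)] op_family_mat_scale[OF assms(1) _ assms(3)]
      by simp
  qed
  have "G = mat n n (\<lambda>ab. if ab \<in> {..<n} \<times> {..<n} then G $$ ab else 0)"
    using assms(2) by (intro eq_matI) auto
  then show ?thesis using part[of "{..<n} \<times> {..<n}"] by simp
qed

lemma op_family_unit_bound:
  obtains a where "0 \<le> a" "\<And>j ik x. j < d \<Longrightarrow> x \<in> S \<Longrightarrow> ik \<in> {..<n} \<times> {..<n} \<Longrightarrow>
    norm (A j (mat_unit n ik) x) \<le> a * norm x"
proof -
  have "\<exists>K. \<forall>x\<in>S. norm (A j (mat_unit n ik) x) \<le> K * norm x" if "j < d" for j ik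
    using op_family_bounded[OF that mat_unit_carrier] .
  then obtain K where K: "\<And>j ik x. j < d \<Longrightarrow> x \<in> S \<Longrightarrow> norm (A j (mat_unit n ik) x) \<le> K j ik * norm x"
    by metis
  define a where "a = (\<Sum>j<d. \<Sum>ik\<in>{..<n} \<times> {..<n}. \<bar>K j ik\<bar>)"
  have "K j ik \<le> a" if "j < d" "ik \<in> {..<n} \<times> {..<n}" for j ik
  proof -
    have "K j ik \<le> \<bar>K j ik\<bar>" by simp
    also have "\<dots> \<le> (\<Sum>ik\<in>{..<n} \<times> {..<n}. \<bar>K j ik\<bar>)"
      by (rule member_le_sum) (use that in auto)
    also have "\<dots> \<le> a" unfolding a_def
      by (rule member_le_sum[where f = "\<lambda>j. \<Sum>ik\<in>{..<n} \<times> {..<n}. \<bar>K j ik\<bar>"]) (use that in \<open>auto intro: sum_nonneg\<close>)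
    finally show ?thesis .
  qed
  then have "norm (A j (mat_unit n ik) x) \<le> a * norm x"
    if "j < d" "x \<in> S" "ik \<in> {..<n} \<times> {..<n}" for j ik x
    by (rule order_trans[OF K[OF that(1,2)] mult_right_mono[OF _ norm_ge_zero]]) (use that in auto)
  moreover have "0 \<le> a" by (simp add: a_def sum_nonneg)
  ultimately show thesis using that by blast
qed

text \<open>The constant does not depend on \<open>m\<close>; this is what makes the domain of the transfer function
  a uniform neighbourhood of the centre.\<close>

lemma LA_bound:
  obtains K where "0 \<le> K"
    and "\<forall>m Z \<beta>. \<forall>v\<in>tens m S. (\<forall>j<d. mat_bounded (m * n) (Z ! j) \<beta>) \<longrightarrow> 0 \<le> \<beta> \<longrightarrow>
           tnorm m (\<lambda>p. v p - LA n d A m Z v p) \<le> K * \<beta> * tnorm m v"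
proof -
  obtain a where a: "0 \<le> a" and unit: "\<And>j ik x. j < d \<Longrightarrow> x \<in> S \<Longrightarrow> ik \<in> {..<n} \<times> {..<n} \<Longrightarrow>
      norm (A j (mat_unit n ik) x) \<le> a * norm x"
    using op_family_unit_bound by blast
  \<comment> \<open>There are \<open>d * (n * n)\<close> summands, one for each coordinate and
    matrix unit, and each is at most \<open>a * \<beta>\<close> times the norm of
    \<open>v\<close>.\<close>
  define K where "K = real d * real (n * n) * a"
  have "tnorm m (\<lambda>p. v p - LA n d A m Z v p) \<le> K * \<beta> * tnorm m v"
    if Z: "\<And>j. j < d \<Longrightarrow> mat_bounded (m * n) (Z ! j) \<beta>" and \<beta>: "0 \<le> \<beta>" and v: "v \<in> tens m S" for m Z \<beta> v
  proof -
    \<comment> \<open>Interchanging the sum over blocks with the sum over matrix units moves the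
      operator out of the former; what remains inside is a scalar matrix applied to
      \<open>v\<close>, as in \<open>mat_bounded_block\<close>.\<close>
    define w where "w j ik p = (\<Sum>q<m. (Z ! j) $$ (p * n + fst ik, q * n + snd ik) *\<^sub>C v q)" for j ik p
    have w_in: "w j ik p \<in> S" for j ik p
      unfolding w_def using v
      by (intro csubspace_sum csubspace_scaleC op_family_csubspace) (auto simp: tens_def)
    have eq: "v p - LA n d A m Z v p = (\<Sum>j<d. \<Sum>ik\<in>{..<n} \<times> {..<n}. A j (mat_unit n ik) (w j ik p))"
      if p: "p < m" for p
    proof -
      have "(\<Sum>q<m. A j (blk n (Z ! j) p q) (v q)) = (\<Sum>ik\<in>{..<n} \<times> {..<n}. A j (mat_unit n ik) (w j ik p))"
        if j: "j < d" for j
      proof -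
        have "(\<Sum>q<m. A j (blk n (Z ! j) p q) (v q)) = (\<Sum>q<m. \<Sum>ik\<in>{..<n} \<times> {..<n}.
            (Z ! j) $$ (p * n + fst ik, q * n + snd ik) *\<^sub>C A j (mat_unit n ik) (v q))"
        proof (rule sum.cong[OF refl])
          fix q assume "q \<in> {..<m}"
          then have vq: "v q \<in> S" using v by (simp add: tens_def)
          have "blk n (Z ! j) p q \<in> carrier_mat n n" by (simp add: blk_def)
          from op_family_mat_expand[OF j this vq]
          have "A j (blk n (Z ! j) p q) (v q) = (\<Sum>ik\<in>{..<n} \<times> {..<n}.
              blk n (Z ! j) p q $$ ik *\<^sub>C A j (mat_unit n ik) (v q))" .
          also have "\<dots> = (\<Sum>ik\<in>{..<n} \<times> {..<n}.
            (Z ! j) $$ (p * n + fst ik, q * n + snd ik) *\<^sub>C A j (mat_unit n ik) (v q))"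
            by (intro sum.cong) (auto simp: blk_def)
          finally show "A j (blk n (Z ! j) p q) (v q) = (\<Sum>ik\<in>{..<n} \<times> {..<n}.
            (Z ! j) $$ (p * n + fst ik, q * n + snd ik) *\<^sub>C A j (mat_unit n ik) (v q))" .
        qed
        also have "\<dots> = (\<Sum>ik\<in>{..<n} \<times> {..<n}. \<Sum>q<m.
            (Z ! j) $$ (p * n + fst ik, q * n + snd ik) *\<^sub>C A j (mat_unit n ik) (v q))"
          by (rule sum.swap)
        also have "\<dots> = (\<Sum>ik\<in>{..<n} \<times> {..<n}. A j (mat_unit n ik) (w j ik p))"
          unfolding w_def using v j
          by (intro sum.cong refl)
            (subst op_family_sum, auto simp: tens_def op_family_scaleC csubspace_scaleC[OF op_family_csubspace])
        finally show ?thesis .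
      qed
      then show ?thesis using p by (simp add: LA_def)
    qed
    have "tnorm m (\<lambda>p. v p - LA n d A m Z v p)
        = tnorm m (\<lambda>p. \<Sum>j<d. \<Sum>ik\<in>{..<n} \<times> {..<n}. A j (mat_unit n ik) (w j ik p))"
      unfolding tnorm_def using eq by simp
    also have "\<dots> \<le> (\<Sum>j<d. tnorm m (\<lambda>p. \<Sum>ik\<in>{..<n} \<times> {..<n}. A j (mat_unit n ik) (w j ik p)))"
      by (rule tnorm_sum)
    also have "\<dots> \<le> (\<Sum>j<d. \<Sum>ik\<in>{..<n} \<times> {..<n}. tnorm m (\<lambda>p. A j (mat_unit n ik) (w j ik p)))"
      by (intro sum_mono tnorm_sum)
    also have "\<dots> \<le> (\<Sum>j<d. \<Sum>ik\<in>{..<n} \<times> {..<n}. a * (\<beta> * tnorm m v))"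
    proof (intro sum_mono)
      fix j ik assume j: "j \<in> {..<d}" and ik: "ik \<in> {..<n} \<times> {..<n}"
      have "tnorm m (\<lambda>p. A j (mat_unit n ik) (w j ik p)) \<le> a * tnorm m (w j ik)"
        using j ik by (intro tnorm_bound unit w_in a) auto
      also have "\<dots> \<le> a * (\<beta> * tnorm m v)"
        unfolding w_def using Z j ik a by (intro mult_left_mono mat_bounded_block) auto
      finally show "tnorm m (\<lambda>p. A j (mat_unit n ik) (w j ik p)) \<le> a * (\<beta> * tnorm m v)" .
    qed
    also have "\<dots> = K * \<beta> * tnorm m v" by (simp add: K_def card_cartesian_product)
    finally show ?thesis .
  qed
  moreover have "0 \<le> K" using a by (simp add: K_def)
  ultimately show thesis by (intro that[of K]) blast+
qed

lemma LA_zero: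
  assumes Z: "\<And>j. j < d \<Longrightarrow> Z ! j = 0\<^sub>m (m * n) (m * n)" and v: "v \<in> tens m S"
  shows "LA n d A m Z v = v"
proof
  fix p
  have "A j (blk n (Z ! j) p q) (v q) = 0" if "p < m" "j < d" "q < m" for j q
  proof -
    have "blk n (Z ! j) p q = 0 \<cdot>\<^sub>m 0\<^sub>m n n"
      using that Z by (intro eq_matI) (auto simp: blk_def block_index_less)
    then show ?thesis using op_family_mat_scale[of j "0\<^sub>m n n" "v q" 0] that v by (simp add: tens_def)
  qed
  then show "LA n d A m Z v p = v p" using v by (simp add: LA_def tens_def)
qed

lemma LA_in_tens: "v \<in> tens m S \<Longrightarrow> LA n d A m Z v \<in> tens m S"
  unfolding tens_def LA_def
  by (auto simp: blk_def intro!: csubspace_diff csubspace_sum op_family_csubspace op_family_in)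

lemma LA_vec_diff:
  assumes "u \<in> tens m S" "v \<in> tens m S"
  shows "LA n d A m Z (\<lambda>p. u p - v p) = (\<lambda>p. LA n d A m Z u p - LA n d A m Z v p)"
proof
  fix p
  have "(\<Sum>j<d. \<Sum>q<m. A j (blk n (Z ! j) p q) (u q - v q))
     = (\<Sum>j<d. \<Sum>q<m. A j (blk n (Z ! j) p q) (u q) - A j (blk n (Z ! j) p q) (v q))"
    using assms by (intro sum.cong refl op_family_diff) (auto simp: tens_def blk_def)
  then show "LA n d A m Z (\<lambda>p. u p - v p) p = LA n d A m Z u p - LA n d A m Z v p"
    by (simp add: LA_def sum_subtractf)
qed

lemma LA_tens_op:
  assumes Z: "\<And>j. j < d \<Longrightarrow> Z ! j \<in> carrier_mat (m * n) (m * n)"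
  shows "tens_op m S (LA n d A m Z)"
proof -
  define \<beta> where "\<beta> = (\<Sum>j<d. \<Sum>i<m * n. \<Sum>l<m * n. cmod ((Z ! j) $$ (i, l)))"
  have \<beta>0: "0 \<le> \<beta>" unfolding \<beta>_def by (intro sum_nonneg norm_ge_zero)
  have \<beta>: "mat_bounded (m * n) (Z ! j) \<beta>" if "j < d" for j
  proof -
    have "(\<Sum>i<m * n. \<Sum>l<m * n. cmod ((Z ! j) $$ (i, l))) \<le> \<beta>" unfolding \<beta>_def
      by (rule member_le_sum[where f = "\<lambda>j. \<Sum>i<m * n. \<Sum>l<m * n. cmod ((Z ! j) $$ (i, l))"])
        (use that in \<open>auto intro!: sum_nonneg\<close>)
    then show ?thesis by (rule mat_bounded_mono[OF mat_bounded_entries[OF Z[OF that]]])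
  qed
  obtain K where "\<forall>m Z \<beta>. \<forall>v\<in>tens m S. (\<forall>j<d. mat_bounded (m * n) (Z ! j) \<beta>) \<longrightarrow> 0 \<le> \<beta> \<longrightarrow>
      tnorm m (\<lambda>p. v p - LA n d A m Z v p) \<le> K * \<beta> * tnorm m v"
    by (rule LA_bound)
  then have K: "tnorm m (\<lambda>p. v p - LA n d A m Z v p) \<le> K * \<beta> * tnorm m v" if "v \<in> tens m S" for v
    using \<beta> \<beta>0 that by blast
  have "tnorm m (LA n d A m Z v) \<le> (1 + K * \<beta>) * tnorm m v" if v: "v \<in> tens m S" for v
  proof -
    have "tnorm m (\<lambda>p. LA n d A m Z v p - v p) = tnorm m (\<lambda>p. v p - LA n d A m Z v p)"
      by (simp add: tnorm_def norm_minus_commute)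
    then show ?thesis
      using tnorm_triangle[of m "\<lambda>p. LA n d A m Z v p - v p" v] K[OF v] by (simp add: algebra_simps)
  qed
  then show ?thesis unfolding tens_op_def using LA_in_tens LA_vec_diff by blast
qed

text \<open>\<open>LA\<close> is affine in the matrix tuple, so a difference of two pencils has the
  form that \<open>LA_bound\<close> estimates.\<close>

lemma LA_mat_diff:
  assumes Z: "\<And>j. j < d \<Longrightarrow> Z ! j \<in> carrier_mat (m * n) (m * n)" "length Z = d"
    and Z': "\<And>j. j < d \<Longrightarrow> Z' ! j \<in> carrier_mat (m * n) (m * n)" "length Z' = d"
    and v: "v \<in> tens m S"
  shows "LA n d A m Z' v p - LA n d A m Z v p = v p - LA n d A m (map2 (-) Z Z') v p"
proof (cases "p < m")
  case True
  have "A j (blk n (map2 (-) Z Z' ! j) p q) (v q)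
      = A j (blk n (Z ! j) p q) (v q) - A j (blk n (Z' ! j) p q) (v q)" if "j < d" "q < m" for j q
  proof -
    have "blk n (map2 (-) Z Z' ! j) p q = blk n (Z ! j) p q - blk n (Z' ! j) p q"
      using that Z Z' True
      by (intro eq_matI) (auto simp: blk_def block_index_less carrier_matD[OF Z'(1)])
    then show ?thesis using that v by (simp add: op_family_mat_diff tens_def blk_def)
  qed
  then have "(\<Sum>j<d. \<Sum>q<m. A j (blk n (map2 (-) Z Z' ! j) p q) (v q))
     = (\<Sum>j<d. \<Sum>q<m. A j (blk n (Z ! j) p q) (v q) - A j (blk n (Z' ! j) p q) (v q))"
    by (intro sum.cong refl) auto
  then show ?thesis using True by (simp add: LA_def sum_subtractf)
qed (use v in \<open>simp add: LA_def tens_def\<close>)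

end

section \<open>The column norm and invertibility near the centre\<close>

lemma ampl_carrier [simp]: "ampl m k Z \<in> carrier_mat (m * k) (m * k)"
  by (simp add: ampl_def)

lemma ncpt_amplt: "ncpt d n Y \<Longrightarrow> ncpt d (m * n) (amplt m n Y)"
  by (simp add: ncpt_def amplt_def)

lemma ncpt_diff: "ncpt d N X \<Longrightarrow> ncpt d N X' \<Longrightarrow> ncpt d N (map2 (-) X X')"
  by (auto simp: ncpt_def intro!: minus_carrier_mat)

lemma ncptD: "ncpt d N X \<Longrightarrow> j < d \<Longrightarrow> X ! j \<in> carrier_mat N N"
  and ncpt_length: "ncpt d N X \<Longrightarrow> length X = d"
  by (simp_all add: ncpt_def)

lemma vnorm_smult: "vnorm (a \<cdot>\<^sub>v x) = cmod a * vnorm x"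
  by (simp add: vnorm_def norm_mult power_mult_distrib real_sqrt_mult flip: sum_distrib_left)

text \<open>A real \<open>Sup\<close> dominates the members of its set only if that set is bounded
  above; the entry bounds supply this.\<close>

lemma vnorm_le_colnorm_on_ball:
  assumes X: "ncpt d N X" and x: "x \<in> carrier_vec N" "vnorm x \<le> 1"
  shows "sqrt (\<Sum>j<length X. (vnorm (X ! j *\<^sub>v x))\<^sup>2) \<le> colnorm N X"
  unfolding colnorm_def
proof (rule cSup_upper)
  define \<beta> where "\<beta> j = (\<Sum>i<N. \<Sum>l<N. cmod ((X ! j) $$ (i, l)))" for j
  show "bdd_above {sqrt (\<Sum>j<length X. (vnorm (X ! j *\<^sub>v v))\<^sup>2) | v. v \<in> carrier_vec N \<and> vnorm v \<le> 1}"
  proof (rule bdd_aboveI)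
    fix t assume "t \<in> {sqrt (\<Sum>j<length X. (vnorm (X ! j *\<^sub>v v))\<^sup>2) | v. v \<in> carrier_vec N \<and> vnorm v \<le> 1}"
    then obtain v where v: "v \<in> carrier_vec N" "vnorm v \<le> 1"
      and t: "t = L2_set (\<lambda>j. vnorm (X ! j *\<^sub>v v)) {..<length X}"
      by (auto simp: L2_set_def)
    have "t \<le> (\<Sum>j<length X. vnorm (X ! j *\<^sub>v v))"
      unfolding t by (intro L2_set_le_sum) simp
    also have "\<dots> \<le> (\<Sum>j<length X. \<beta> j)"
    proof (rule sum_mono)
      fix j assume "j \<in> {..<length X}"
      then have "mat_bounded N (X ! j) (\<beta> j)"
        unfolding \<beta>_def using X by (intro mat_bounded_entries) (simp add: ncpt_def)
      then have "0 \<le> \<beta> j" "vnorm (X ! j *\<^sub>v v) \<le> \<beta> j * vnorm v" using v by (auto simp: mat_bounded_def)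
      then show "vnorm (X ! j *\<^sub>v v) \<le> \<beta> j" using v(2) mult_left_mono[of "vnorm v" 1 "\<beta> j"] by simp
    qed
    finally show "t \<le> (\<Sum>j<length X. \<beta> j)" .
  qed
qed (use x in blast)

lemma colnorm_nonneg: "ncpt d N X \<Longrightarrow> 0 \<le> colnorm N X"
  by (rule order_trans[OF _ vnorm_le_colnorm_on_ball[of d N X "0\<^sub>v N"]])
    (auto simp: vnorm_def intro!: sum_nonneg)

text \<open>Each component is one block of the stacked matrix and so has no larger norm; homogeneity
  carries the estimate from unit vectors to all vectors.\<close>

lemma mat_bounded_colnorm:
  assumes X: "ncpt d N X" and j: "j < d"
  shows "mat_bounded N (X ! j) (colnorm N X)"
  unfolding mat_bounded_def
proof (intro conjI ballI colnorm_nonneg[OF X] ncptD[OF X j])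
  fix x :: "complex Matrix.vec" assume x: "x \<in> carrier_vec N"
  note Xj = ncptD[OF X j]
  show "vnorm (X ! j *\<^sub>v x) \<le> colnorm N X * vnorm x"
  proof (cases "vnorm x = 0")
    case True
    \<comment> \<open>A vector of norm zero cannot be normalized; the entry bound shows that its
      image has norm zero too.\<close>
    then show ?thesis using mat_bounded_entries[OF Xj] x by (auto simp: mat_bounded_def)
  next
    case False
    then have pos: "0 < vnorm x" using vnorm_nonneg[of x] by linarith
    define y where "y = complex_of_real (1 / vnorm x) \<cdot>\<^sub>v x"
    have y: "y \<in> carrier_vec N" "vnorm y = 1" using x pos by (auto simp: y_def vnorm_smult norm_divide)
    have "vnorm (X ! j *\<^sub>v y) = vnorm (X ! j *\<^sub>v x) / vnorm x"
      unfolding y_def using mult_mat_vec[OF Xj x] pos by (simp add: vnorm_smult norm_divide)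
    moreover have "vnorm (X ! j *\<^sub>v y) \<le> sqrt (\<Sum>j<length X. (vnorm (X ! j *\<^sub>v y))\<^sup>2)"
      using member_le_L2_set[of "{..<length X}" j "\<lambda>j. vnorm (X ! j *\<^sub>v y)"] j X
      by (simp add: L2_set_def ncpt_def)
    ultimately have "vnorm (X ! j *\<^sub>v x) / vnorm x \<le> colnorm N X"
      using vnorm_le_colnorm_on_ball[OF X y(1)] y(2) by simp
    then show ?thesis using pos by (simp add: field_simps)
  qed
qed

text \<open>Puts the centre into its own uniform ball, at level \<open>m = 1\<close>.\<close>

lemma colnorm_diff_self:
  assumes Y: "ncpt d n Y"
  shows "colnorm (1 * n) (map2 (-) Y (amplt 1 n Y)) = 0"
proof -
  have "map2 (-) Y (amplt 1 n Y) ! j = 0\<^sub>m n n" if "j < d" for j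
    using Y that by (intro eq_matI) (auto simp: ncpt_def amplt_def ampl_def)
  moreover have "length (map2 (-) Y (amplt 1 n Y)) = d" using Y by (simp add: ncpt_def amplt_def)
  ultimately have zero: "sqrt (\<Sum>j<length (map2 (-) Y (amplt 1 n Y)).
      (vnorm (map2 (-) Y (amplt 1 n Y) ! j *\<^sub>v v))\<^sup>2) = 0" if "v \<in> carrier_vec n" for v
    using that by (simp add: vnorm_def)
  have "{sqrt (\<Sum>j<length (map2 (-) Y (amplt 1 n Y)).
      (vnorm (map2 (-) Y (amplt 1 n Y) ! j *\<^sub>v v))\<^sup>2) | v. v \<in> carrier_vec n \<and> vnorm v \<le> 1} = {0}"
    (is "?D = _")
  proof
    show "?D \<subseteq> {0}" using zero by auto
    have "0\<^sub>v n \<in> carrier_vec n" "vnorm (0\<^sub>v n) \<le> 1" by (simp_all add: vnorm_def)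
    then have "0 \<in> ?D" by (intro CollectI exI[of _ "0\<^sub>v n"] conjI zero[symmetric])
    then show "{0} \<subseteq> ?D" by blast
  qed
  then show ?thesis by (simp add: colnorm_def)
qed

text \<open>\<open>Dpath\<close> prescribes continuity of the matrix entries. An estimate by entries
  converts this into continuity of the pencil in operator norm.\<close>

lemma LA_diff_bound:
  assumes fam: "op_family S n d A"
  obtains K where "0 \<le> K" and "\<And>m Z Z' v. ncpt d (m * n) Z \<Longrightarrow> ncpt d (m * n) Z' \<Longrightarrow> v \<in> tens m S \<Longrightarrow>
    tnorm m (\<lambda>p. LA n d A m Z v p - LA n d A m Z' v p)
      \<le> K * (\<Sum>j<d. \<Sum>i<m * n. \<Sum>l<m * n. cmod ((Z ! j) $$ (i, l) - (Z' ! j) $$ (i, l))) * tnorm m v"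
proof -
  obtain K where K0: "0 \<le> K" and "\<forall>m Z \<beta>. \<forall>v\<in>tens m S. (\<forall>j<d. mat_bounded (m * n) (Z ! j) \<beta>) \<longrightarrow> 0 \<le> \<beta> \<longrightarrow>
      tnorm m (\<lambda>p. v p - LA n d A m Z v p) \<le> K * \<beta> * tnorm m v"
    by (rule LA_bound[OF fam])
  then have K: "tnorm m (\<lambda>p. v p - LA n d A m Z v p) \<le> K * \<beta> * tnorm m v"
    if "\<And>j. j < d \<Longrightarrow> mat_bounded (m * n) (Z ! j) \<beta>" "0 \<le> \<beta>" "v \<in> tens m S" for m Z \<beta> v
    using that by blast
  have "tnorm m (\<lambda>p. LA n d A m Z v p - LA n d A m Z' v p)
      \<le> K * (\<Sum>j<d. \<Sum>i<m * n. \<Sum>l<m * n. cmod ((Z ! j) $$ (i, l) - (Z' ! j) $$ (i, l))) * tnorm m v"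
    if Z: "ncpt d (m * n) Z" and Z': "ncpt d (m * n) Z'" and v: "v \<in> tens m S" for m Z Z' v
  proof -
    define g where "g j = (\<Sum>i<m * n. \<Sum>l<m * n. cmod ((Z ! j) $$ (i, l) - (Z' ! j) $$ (i, l)))" for j
    have g0: "0 \<le> g j" for j unfolding g_def by (intro sum_nonneg norm_ge_zero)
    define D where "D = map2 (-) Z' Z"
    have D: "ncpt d (m * n) D" unfolding D_def by (rule ncpt_diff[OF Z' Z])
    have "mat_bounded (m * n) (D ! j) (sum g {..<d})" if j: "j < d" for j
    proof (rule mat_bounded_mono)
      show "mat_bounded (m * n) (D ! j) (\<Sum>i<m * n. \<Sum>l<m * n. cmod ((D ! j) $$ (i, l)))"
        by (rule mat_bounded_entries[OF ncptD[OF D j]])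
      have "(\<Sum>i<m * n. \<Sum>l<m * n. cmod ((D ! j) $$ (i, l))) = g j"
        unfolding g_def D_def using j ncptD[OF Z j] ncptD[OF Z' j] ncpt_length[OF Z] ncpt_length[OF Z']
        by (intro sum.cong refl) (auto simp: norm_minus_commute)
      also have "\<dots> \<le> sum g {..<d}" by (rule member_le_sum) (use j g0 in auto)
      finally show "(\<Sum>i<m * n. \<Sum>l<m * n. cmod ((D ! j) $$ (i, l))) \<le> sum g {..<d}" .
    qed
    then have "tnorm m (\<lambda>p. v p - LA n d A m D v p) \<le> K * sum g {..<d} * tnorm m v"
      by (intro K v sum_nonneg g0)
    moreover have "(\<lambda>p. LA n d A m Z v p - LA n d A m Z' v p) = (\<lambda>p. v p - LA n d A m D v p)"
      unfolding D_def
      by (intro ext LA_mat_diff[OF fam] ncptD[OF Z] ncptD[OF Z'] ncpt_length[OF Z] ncpt_length[OF Z'] v)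
    ultimately show ?thesis by (simp add: g_def)
  qed
  then show thesis using that K0 by blast
qed

text \<open>At the centre the pencil is the identity, whose lower bound is 1. Both perturbation
  lemmas apply once \<open>K\<close> times the column norm is below 1, a condition free of
  \<open>m\<close>.\<close>

lemma LA_invertible_near_center:
  assumes fam: "op_family S n d A" and Y: "ncpt d n Y"
  obtains r where "0 < r" and "\<And>m X. ncpt d (m * n) X \<Longrightarrow>
    colnorm (m * n) (map2 (-) X (amplt m n Y)) < r \<Longrightarrow>
    inv_op m S (LA n d A m (map2 (-) X (amplt m n Y)))"
proof -
  have S: "closed_csubspace S" using fam by (simp add: op_family_def)
  then have cs: "csubspace S" by (simp add: closed_csubspace_def)
  obtain K where K0: "0 \<le> K" and "\<forall>m Z \<beta>. \<forall>v\<in>tens m S. (\<forall>j<d. mat_bounded (m * n) (Z ! j) \<beta>) \<longrightarrow> 0 \<le> \<beta> \<longrightarrow>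
      tnorm m (\<lambda>p. v p - LA n d A m Z v p) \<le> K * \<beta> * tnorm m v"
    by (rule LA_bound[OF fam])
  then have K: "tnorm m (\<lambda>p. v p - LA n d A m Z v p) \<le> K * \<beta> * tnorm m v"
    if "\<And>j. j < d \<Longrightarrow> mat_bounded (m * n) (Z ! j) \<beta>" "0 \<le> \<beta>" "v \<in> tens m S" for m Z \<beta> v
    using that by blast
  \<comment> \<open>Adding 1 avoids division by zero when \<open>K = 0\<close>; the choice ensures
    \<open>K * r < 1\<close>.\<close>
  define r where "r = 1 / (2 * (K + 1))"
  have r: "0 < r" using K0 by (simp add: r_def)
  have "inv_op m S (LA n d A m (map2 (-) X (amplt m n Y)))"
    if X: "ncpt d (m * n) X" and small: "colnorm (m * n) (map2 (-) X (amplt m n Y)) < r" for m X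
  proof -
    define Z where "Z = map2 (-) X (amplt m n Y)"
    have Z: "ncpt d (m * n) Z" unfolding Z_def by (intro ncpt_diff X ncpt_amplt Y)
    have op: "tens_op m S (LA n d A m Z)" by (rule LA_tens_op[OF fam]) (rule ncptD[OF Z])
    have close: "tnorm m (\<lambda>p. v p - LA n d A m Z v p) \<le> (K * colnorm (m * n) Z) * tnorm m v"
      if "v \<in> tens m S" for v
      by (intro K mat_bounded_colnorm[OF Z] colnorm_nonneg[OF Z] that)
    have "K * colnorm (m * n) Z \<le> K * r" using small K0 by (intro mult_left_mono) (auto simp: Z_def)
    also have "\<dots> < 1" using K0 by (simp add: r_def field_simps)
    finally have lt: "K * colnorm (m * n) Z < 1" .
    have id: "bdd_below_by 1 m S (\<lambda>v. v)" by (simp add: bdd_below_by_def)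
    have "bdd_below_by (1 - K * colnorm (m * n) Z) m S (LA n d A m Z)"
      by (rule perturb_bdd_below[OF id lt close])
    moreover have "tens m S \<subseteq> LA n d A m Z ` tens m S"
      by (rule perturb_surj[OF S op id _ _ lt close]) (use K0 colnorm_nonneg[OF Z] in auto)
    ultimately show ?thesis unfolding Z_def[symmetric] inv_op_iff[OF cs op] by blast
  qed
  then show thesis using that r by blast
qed

text \<open>Method of continuity: the set of \<open>t\<close> for which \<open>L_A\<close> maps the invariant subspace
  \<open>\<complex>^m \<otimes> S\<close> onto itself is open and closed in the unit interval, because \<open>L_A\<close> is bounded
  below along the whole path.\<close>

lemma path_component_preserves_invariant_subspace:
  fixes S :: "'a::chilbert_space set"
  assumes famU: "op_family UNIV n d A" and fam: "op_family S n d A" and Y: "ncpt d n Y"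
    and \<gamma>: "\<And>t. t \<in> {0..1::real} \<Longrightarrow> \<gamma> t \<in> Dm UNIV n d Y A m"
    and cont: "\<And>j i l. j < d \<Longrightarrow> i < m * n \<Longrightarrow> l < m * n \<Longrightarrow> continuous_on {0..1} (\<lambda>t. (\<gamma> t ! j) $$ (i, l))"
    and start: "\<gamma> 0 = amplt m n Y"
  shows "tens m S \<subseteq> LA n d A m (map2 (-) (\<gamma> 1) (amplt m n Y)) ` tens m S"
proof -
  have S: "closed_csubspace S" using fam by (simp add: op_family_def)
  then have cs: "csubspace S" by (simp add: closed_csubspace_def)
  note csU = op_family_csubspace[OF famU]
  define Z where "Z t = map2 (-) (\<gamma> t) (amplt m n Y)" for t
  define L where "L t = LA n d A m (Z t)" for t
  have \<gamma>n: "ncpt d (m * n) (\<gamma> t)" if "t \<in> {0..1}" for t using \<gamma>[OF that] by (simp add: Dm_def)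
  have Zn: "ncpt d (m * n) (Z t)" if "t \<in> {0..1}" for t
    unfolding Z_def by (intro ncpt_diff \<gamma>n that ncpt_amplt Y)
  have op: "tens_op m S (L t)" if "t \<in> {0..1}" for t
    unfolding L_def by (rule LA_tens_op[OF fam]) (rule ncptD[OF Zn[OF that]])
  have opU: "tens_op m UNIV (L t)" if "t \<in> {0..1}" for t
    unfolding L_def by (rule LA_tens_op[OF famU]) (rule ncptD[OF Zn[OF that]])
  have below: "\<exists>k. bdd_below_by k m S (L t)" if t: "t \<in> {0..1}" for t
  proof -
    have "inv_op m UNIV (L t)" using \<gamma>[OF t] by (simp add: Dm_def L_def Z_def)
    then obtain k where "bdd_below_by k m UNIV (L t)" using inv_op_iff[OF csU opU[OF t]] by blast
    \<comment> \<open>The lower bound comes from invertibility on the whole space and is merely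
      restricted to \<open>S\<close>.\<close>
    then have "bdd_below_by k m S (L t)" by (auto simp: bdd_below_by_def tens_def)
    then show ?thesis by blast
  qed
  define dist_\<gamma> where "dist_\<gamma> s t =
    (\<Sum>j<d. \<Sum>i<m * n. \<Sum>l<m * n. cmod ((\<gamma> s ! j) $$ (i, l) - (\<gamma> t ! j) $$ (i, l)))" for s t
  have dist_comm: "dist_\<gamma> s t = dist_\<gamma> t s" for s t by (simp add: dist_\<gamma>_def norm_minus_commute)
  have dist_nonneg: "0 \<le> dist_\<gamma> s t" for s t unfolding dist_\<gamma>_def by (intro sum_nonneg norm_ge_zero)
  obtain K where K0: "0 \<le> K" and K: "\<And>m Z Z' v. ncpt d (m * n) Z \<Longrightarrow> ncpt d (m * n) Z' \<Longrightarrow> v \<in> tens m S \<Longrightarrow>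
    tnorm m (\<lambda>p. LA n d A m Z v p - LA n d A m Z' v p)
      \<le> K * (\<Sum>j<d. \<Sum>i<m * n. \<Sum>l<m * n. cmod ((Z ! j) $$ (i, l) - (Z' ! j) $$ (i, l))) * tnorm m v"
    by (rule LA_diff_bound[OF fam]) (rule that)
  have close: "tnorm m (\<lambda>p. L s v p - L t v p) \<le> (K * dist_\<gamma> s t) * tnorm m v"
    if s: "s \<in> {0..1}" and t: "t \<in> {0..1}" and v: "v \<in> tens m S" for s t v
  proof -
    \<comment> \<open>The centre cancels in the difference of the shifted tuples, so the distance
      can be measured on the path itself.\<close>
    have "(\<Sum>j<d. \<Sum>i<m * n. \<Sum>l<m * n. cmod ((Z s ! j) $$ (i, l) - (Z t ! j) $$ (i, l))) = dist_\<gamma> s t"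
      unfolding dist_\<gamma>_def Z_def
      using ncptD[OF \<gamma>n[OF s]] ncptD[OF \<gamma>n[OF t]] ncptD[OF ncpt_amplt[OF Y]]
        ncpt_length[OF \<gamma>n[OF s]] ncpt_length[OF \<gamma>n[OF t]] ncpt_length[OF ncpt_amplt[OF Y]]
      by (intro sum.cong refl) (auto simp: carrier_matD[OF ncptD[OF ncpt_amplt[OF Y]]])
    then show ?thesis using K[OF Zn[OF s] Zn[OF t] v] by (simp add: L_def)
  qed
  define P where "P t \<longleftrightarrow> tens m S \<subseteq> L t ` tens m S" for t
  have "P 1"
  proof (rule connected_induction_simple[where S = "{0..1}" and a = 0])
    have "Z 0 ! j = 0\<^sub>m (m * n) (m * n)" if j: "j < d" for j
      unfolding Z_def start
      using j ncpt_length[OF ncpt_amplt[OF Y]] minus_r_inv_mat[OF ncptD[OF ncpt_amplt[OF Y] j]] by simp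
    then have "L 0 v = v" if "v \<in> tens m S" for v
      unfolding L_def by (rule LA_zero[OF fam _ that])
    then have "tens m S \<subseteq> L 0 ` tens m S" by force
    then show "P 0" by (simp add: P_def)
  next
    fix t assume t: "t \<in> {0..1::real}"
    obtain k where k: "bdd_below_by k m S (L t)" using below[OF t] by blast
    then have k0: "0 < k" by (simp add: bdd_below_by_def)
    have "continuous_on {0..1} (\<lambda>s. K * dist_\<gamma> s t)"
      unfolding dist_\<gamma>_def by (intro continuous_intros cont) auto
    then have "openin (top_of_set {0..1}) ({0..1} \<inter> (\<lambda>s. K * dist_\<gamma> s t) -` {..<k / 2})"
      by (rule continuous_openin_preimage_gen) simp
    moreover have "t \<in> {0..1} \<inter> (\<lambda>s. K * dist_\<gamma> s t) -` {..<k / 2}"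
      using t k0 by (simp add: dist_\<gamma>_def)
    moreover have "P s = P t" if "s \<in> {0..1} \<inter> (\<lambda>s. K * dist_\<gamma> s t) -` {..<k / 2}" for s
    proof -
      have s: "s \<in> {0..1}" and small: "K * dist_\<gamma> s t < k / 2" using that by auto
      have nn: "0 \<le> K * dist_\<gamma> s t" using K0 dist_nonneg by simp
      have ts: "tnorm m (\<lambda>p. L t v p - L s v p) \<le> (K * dist_\<gamma> s t) * tnorm m v" if "v \<in> tens m S" for v
        using close[OF t s that] by (simp add: dist_comm)
      have lt: "K * dist_\<gamma> s t < k" using small k0 by simp
      have ks: "bdd_below_by (k - K * dist_\<gamma> s t) m S (L s)"
        by (rule perturb_bdd_below[OF k lt ts])
      show "P s = P t"
      proof
        assume "P t"
        then show "P s" unfolding P_def by (rule perturb_surj[OF S op[OF s] k _ nn lt ts])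
      next
        \<comment> \<open>This is why the radius is \<open>k / 2\<close>: the lower bound left at
          \<open>s\<close> still exceeds the distance, and surjectivity passes from \<open>s\<close>
          back to \<open>t\<close>.\<close>
        have lt': "K * dist_\<gamma> s t < k - K * dist_\<gamma> s t" using small by simp
        assume "P s"
        then show "P t" unfolding P_def
          by (rule perturb_surj[OF S op[OF t] ks _ nn lt' close[OF s t]])
      qed
    qed
    ultimately show "\<exists>T. openin (top_of_set {0..1}) T \<and> t \<in> T \<and> (\<forall>x\<in>T. \<forall>y\<in>T. P x \<longrightarrow> P y)"
      by blast
  qed auto
  then show ?thesis by (simp add: P_def L_def Z_def)
qed

section \<open>Controllable and observable subspaces\<close>

text \<open>The last letter of a word acts first, so appending a letter evaluates the old word at
  \<open>A i G x\<close>.\<close>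

lemma Aword_append:
  "length w = length Gs \<Longrightarrow> Aword A (w @ [i]) (Gs @ [G]) x = Aword A w Gs (A i G x)"
  by (induction w Gs rule: list_induct2) auto

lemma words_Nil: "([], []) \<in> words n d"
  by (simp add: words_def)

lemma words_Cons: "(i # w, G # Gs) \<in> words n d \<longleftrightarrow> i < d \<and> G \<in> carrier_mat n n \<and> (w, Gs) \<in> words n d"
  by (auto simp: words_def)

lemma words_append:
  "(w, Gs) \<in> words n d \<Longrightarrow> i < d \<Longrightarrow> G \<in> carrier_mat n n \<Longrightarrow> (w @ [i], Gs @ [G]) \<in> words n d"
  by (auto simp: words_def)

lemma words_length: "(w, Gs) \<in> words n d \<Longrightarrow> length w = length Gs"
  by (simp add: words_def)

lemma cadj_carrier [simp]: "G \<in> carrier_mat n n \<Longrightarrow> cadj G \<in> carrier_mat n n"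
  by (simp add: cadj_def)

lemma cadj_cadj [simp]: "cadj (cadj G) = G"
  by (rule eq_matI) (auto simp: cadj_def)

lemma words_cadj: "(w, Gs) \<in> words n d \<Longrightarrow> (w, map cadj Gs) \<in> words n d"
  by (auto simp: words_def)

lemma words_induct [consumes 1, case_names Nil Cons]:
  assumes "(w, Gs) \<in> words n d" "P [] []"
    and "\<And>i G w Gs. i < d \<Longrightarrow> G \<in> carrier_mat n n \<Longrightarrow> (w, Gs) \<in> words n d \<Longrightarrow> P w Gs \<Longrightarrow> P (i # w) (G # Gs)"
  shows "P w Gs"
  using words_length[OF assms(1)] assms
  by (induction w Gs rule: list_induct2) (auto simp: words_Cons)

lemma realization_iff:
  "realization S n d Y A b c \<longleftrightarrow> op_family S n d A \<and> ncpt d n Y \<and>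
     (\<forall>f\<in>{b, c}. f ` carrier_vec n \<subseteq> S \<and>
        (\<forall>u\<in>carrier_vec n. \<forall>v\<in>carrier_vec n. f (u + v) = f u + f v) \<and>
        (\<forall>a. \<forall>u\<in>carrier_vec n. f (a \<cdot>\<^sub>v u) = a *\<^sub>C f u))"
  unfolding realization_def op_family_def by (simp only: conj_ac)

lemma bop_proj: "closed_csubspace M \<Longrightarrow> bop UNIV (proj M)"
  unfolding bop_def by (auto simp: proj_add proj_scaleC intro!: exI[of _ 1] norm_proj_le)

text \<open>With \<open>ccspan_minimal\<close> this reduces the inclusion of an image of a closed
  span in a closed subspace to a check on generators.\<close>

lemma closed_csubspace_vimage:
  assumes T: "bop UNIV T" and S: "closed_csubspace S"
  shows "closed_csubspace {x. T x \<in> S}"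
proof -
  have cs: "csubspace S" and cl: "closed S" using S by (auto simp: closed_csubspace_def)
  have add: "T (x + y) = T x + T y" and scale: "T (a *\<^sub>C x) = a *\<^sub>C T x" for x y a
    using T by (auto simp: bop_def)
  have zero: "T 0 = 0" using scale[of 0 0] by simp
  have diff: "T (x - y) = T x - T y" for x y using add[of "x - y" y] by simp
  obtain K where K: "\<And>x. norm (T x) \<le> K * norm x" using T by (auto simp: bop_def)
  have "closed {x. T x \<in> S}"
    unfolding closed_sequential_limits
  proof (intro allI impI, elim conjE)
    fix x l assume x: "\<forall>i. x i \<in> {x. T x \<in> S}" and l: "x \<longlonglongrightarrow> l"
    have bound: "norm (T (x i) - T l) \<le> K * norm (x i - l)" for i
      using K[of "x i - l"] by (simp add: diff)
    have "(\<lambda>i. K * norm (x i - l)) \<longlonglongrightarrow> 0"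
      by (intro tendsto_mult_right_zero tendsto_norm_zero LIM_zero l)
    then have "(\<lambda>i. T (x i) - T l) \<longlonglongrightarrow> 0"
      by (rule Lim_null_comparison[OF always_eventually[OF allI[OF bound]]])
    then have "(\<lambda>i. T (x i)) \<longlonglongrightarrow> T l" by (rule LIM_zero_cancel)
    then show "l \<in> {x. T x \<in> S}" using closed_sequentially[OF cl, of "\<lambda>i. T (x i)"] x by auto
  qed
  moreover have "csubspace {x. T x \<in> S}"
    using cs unfolding csubspace_def[of "{x. T x \<in> S}"]
    by (auto simp: zero add scale csubspace_0 csubspace_add csubspace_scaleC)
  ultimately show ?thesis by (simp add: closed_csubspace_def)
qed

text \<open>The vectors orthogonal to \<open>x\<close> form a closed subspace, which contains the
  closed span as soon as it contains the generators.\<close>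

lemma orth_ccspan_iff:
  fixes x :: "'a::chilbert_space"
  shows "(\<forall>w\<in>ccspan W. cinner w x = 0) \<longleftrightarrow> (\<forall>w\<in>W. cinner w x = 0)"
proof
  assume *: "\<forall>w\<in>W. cinner w x = 0"
  have sym: "cinner x w = 0 \<longleftrightarrow> cinner w x = 0" for w
    using cinner_commute[of x w] by auto
  have "ccspan W \<subseteq> orth_diff UNIV {x}"
    by (intro ccspan_minimal closed_csubspace_orth_diff closed_csubspace_UNIV)
      (use * in \<open>auto simp: orth_diff_def sym\<close>)
  then show "\<forall>w\<in>ccspan W. cinner w x = 0" by (auto simp: orth_diff_def sym)
qed (use ccspan_superset in blast)

context
  fixes S :: "'a::chilbert_space set" and n d :: nat and A :: "nat \<Rightarrow> complex mat \<Rightarrow> 'a \<Rightarrow> 'a"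
  assumes fam: "op_family S n d A"
begin

lemma op_family_closed_csubspace: "closed_csubspace S"
  and op_family_bop: "j < d \<Longrightarrow> G \<in> carrier_mat n n \<Longrightarrow> bop S (A j G)"
  using fam by (auto simp: op_family_def)

lemma Aword_in: "(w, Gs) \<in> words n d \<Longrightarrow> x \<in> S \<Longrightarrow> Aword A w Gs x \<in> S"
  by (induction rule: words_induct) (auto intro: op_family_in[OF fam])

lemma Adag_in: "(w, Gs) \<in> words n d \<Longrightarrow> y \<in> S \<Longrightarrow> Adag S A w Gs y \<in> S"
  by (induction arbitrary: y rule: words_induct)
    (simp_all add: adj_in[OF op_family_closed_csubspace op_family_bop])

text \<open>\<open>Adag\<close> applies its first letter first and \<open>Aword\<close> applies it
  last. Moving the adjoints across one by one thus keeps the order of the word and only conjugates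
  the matrices.\<close>

lemma cinner_Adag:
  "(w, Gs) \<in> words n d \<Longrightarrow> x \<in> S \<Longrightarrow>
     cinner (Adag S A w Gs y) x = cinner y (Aword A w (map cadj Gs) x)"
proof (induction arbitrary: y rule: words_induct)
  case (Cons i G w Gs)
  let ?z = "Aword A w (map cadj Gs) x"
  have "cinner (A i (cadj G) ?z) y = cinner ?z (adj S (A i (cadj G)) y)"
    using Cons by (intro cinner_adj[OF op_family_closed_csubspace] op_family_bop Aword_in words_cadj) auto
  then have "cinner (adj S (A i (cadj G)) y) ?z = cinner y (A i (cadj G) ?z)"
    by (metis cinner_commute)
  then show ?case using Cons by simp
qed simp

text \<open>Describes the unobservable vectors by their outputs, without adjoints. Conjugation of
  the matrices is an involution on \<open>words\<close>, so it disappears from the quantified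
  condition.\<close>

lemma orth_obs_iff:
  assumes x: "x \<in> S"
  shows "(\<forall>w\<in>obs S n d A b. cinner w x = 0) \<longleftrightarrow>
    (\<forall>(w, Gs)\<in>words n d. \<forall>u\<in>carrier_vec n. cinner (b u) (Aword A w Gs x) = 0)"
proof -
  have "(\<forall>w\<in>obs S n d A b. cinner w x = 0) \<longleftrightarrow>
      (\<forall>(w, Gs)\<in>words n d. \<forall>u\<in>carrier_vec n. cinner (Adag S A w Gs (b u)) x = 0)"
    unfolding obs_def orth_ccspan_iff by blast
  also have "\<dots> \<longleftrightarrow> (\<forall>(w, Gs)\<in>words n d. \<forall>u\<in>carrier_vec n. cinner (b u) (Aword A w (map cadj Gs) x) = 0)"
    using cinner_Adag x by auto
  also have "\<dots> \<longleftrightarrow> (\<forall>(w, Gs)\<in>words n d. \<forall>u\<in>carrier_vec n. cinner (b u) (Aword A w Gs x) = 0)"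
  proof (intro iffI ballI, safe)
    fix w Gs and u :: "complex Matrix.vec"
    assume *: "\<forall>(w, Gs)\<in>words n d. \<forall>u\<in>carrier_vec n. cinner (b u) (Aword A w (map cadj Gs) x) = 0"
      and w: "(w, Gs) \<in> words n d" and u: "u \<in> carrier_vec n"
    have "map cadj (map cadj Gs) = Gs" by (simp add: comp_def)
    then show "cinner (b u) (Aword A w Gs x) = 0" using * words_cadj[OF w] u by fastforce
  next
    fix w Gs and u :: "complex Matrix.vec"
    assume *: "\<forall>(w, Gs)\<in>words n d. \<forall>u\<in>carrier_vec n. cinner (b u) (Aword A w Gs x) = 0"
      and w: "(w, Gs) \<in> words n d" and u: "u \<in> carrier_vec n"
    show "cinner (b u) (Aword A w (map cadj Gs) x) = 0" using * words_cadj[OF w] u by blast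
  qed
  finally show ?thesis .
qed

end

section \<open>Compression to the minimal subspace\<close>

locale hilbert_realization =
  fixes A :: "nat \<Rightarrow> complex mat \<Rightarrow> 'h::chilbert_space \<Rightarrow> 'h"
    and b c :: "complex Matrix.vec \<Rightarrow> 'h" and Y :: "complex mat list" and n d :: nat
  assumes realization: "realization UNIV n d Y A b c"
begin

abbreviation "C \<equiv> ctrl n d A c"
abbreviation "Ob \<equiv> obs UNIV n d A b"
abbreviation "N \<equiv> C \<inter> orth_diff UNIV Ob"
abbreviation "M \<equiv> minsub UNIV n d A b c"
abbreviation "Q \<equiv> proj M"
abbreviation "A0 \<equiv> \<lambda>j G x. Q (A j G x)"

lemma fam: "op_family UNIV n d A" and ncpt_Y: "ncpt d n Y"
  and b_add: "u \<in> carrier_vec n \<Longrightarrow> v \<in> carrier_vec n \<Longrightarrow> b (u + v) = b u + b v"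
  and b_scale: "u \<in> carrier_vec n \<Longrightarrow> b (a \<cdot>\<^sub>v u) = a *\<^sub>C b u"
  and c_add: "u \<in> carrier_vec n \<Longrightarrow> v \<in> carrier_vec n \<Longrightarrow> c (u + v) = c u + c v"
  and c_scale: "u \<in> carrier_vec n \<Longrightarrow> c (a \<cdot>\<^sub>v u) = a *\<^sub>C c u"
  using realization unfolding realization_iff by auto

lemma closed_C: "closed_csubspace C"
  unfolding ctrl_def by (rule closed_csubspace_ccspan)

lemma closed_N: "closed_csubspace N"
  by (intro closed_csubspace_Int closed_C closed_csubspace_orth_diff closed_csubspace_UNIV)

lemma closed_M: "closed_csubspace M"
  unfolding minsub_def by (intro closed_csubspace_orth_diff closed_C)

lemma M_subset_C: "M \<subseteq> C"
  by (auto simp: minsub_def orth_diff_def)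

lemma M_orth_N: "x \<in> M \<Longrightarrow> z \<in> N \<Longrightarrow> cinner x z = 0"
  using cinner_commute[of x z] by (auto simp: minsub_def orth_diff_def)

lemma Aword_c_in_C: "(w, Gs) \<in> words n d \<Longrightarrow> v \<in> carrier_vec n \<Longrightarrow> Aword A w Gs (c v) \<in> C"
  unfolding ctrl_def by (rule subsetD[OF ccspan_superset]) blast

lemma c_in_C: "v \<in> carrier_vec n \<Longrightarrow> c v \<in> C"
  using Aword_c_in_C[OF words_Nil] by simp

text \<open>Prefixing a letter sends generators of \<open>C\<close> to generators; boundedness of
  \<open>A j G\<close> extends this to the closed span.\<close>

lemma A_in_C:
  assumes j: "j < d" and G: "G \<in> carrier_mat n n" and x: "x \<in> C"
  shows "A j G x \<in> C"
proof -
  have "C \<subseteq> {x. A j G x \<in> C}"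
    unfolding ctrl_def[of n d A c]
  proof (rule ccspan_minimal)
    show "closed_csubspace {x. A j G x \<in> ccspan {Aword A w Gs (c v) |w Gs v. (w, Gs) \<in> words n d \<and> v \<in> carrier_vec n}}"
      by (intro closed_csubspace_vimage op_family_bop[OF fam] j G closed_csubspace_ccspan)
    show "{Aword A w Gs (c v) |w Gs v. (w, Gs) \<in> words n d \<and> v \<in> carrier_vec n}
      \<subseteq> {x. A j G x \<in> ccspan {Aword A w Gs (c v) |w Gs v. (w, Gs) \<in> words n d \<and> v \<in> carrier_vec n}}"
    proof safe
      fix w Gs and v :: "complex Matrix.vec" assume w: "(w, Gs) \<in> words n d" and v: "v \<in> carrier_vec n"
      have "Aword A (j # w) (G # Gs) (c v) \<in> C"
        using w v j G by (intro Aword_c_in_C) (simp_all add: words_Cons)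
      then show "A j G (Aword A w Gs (c v))
          \<in> ccspan {Aword A w Gs (c v) |w Gs v. (w, Gs) \<in> words n d \<and> v \<in> carrier_vec n}"
        by (simp add: ctrl_def)
    qed
  qed
  then show ?thesis using x by blast
qed

text \<open>Lets the perturbation lemmas run inside \<open>C\<close>. Since \<open>b\<close> need
  not take values in \<open>C\<close>, the restriction is an \<open>op_family\<close> but in general
  not a \<open>realization\<close>.\<close>

lemma fam_C: "op_family C n d A"
  unfolding op_family_def
proof (intro conjI allI impI ballI closed_C)
  fix j and G :: "complex mat" assume j: "j < d" and G: "G \<in> carrier_mat n n"
  obtain K where "\<forall>x\<in>UNIV. norm (A j G x) \<le> K * norm x"
    using op_family_bounded[OF fam j G] by blast
  then have "\<exists>K. \<forall>x\<in>C. norm (A j G x) \<le> K * norm x" by (intro exI[of _ K]) simp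
  then show "bop C (A j G)"
    unfolding bop_def using op_family_add[OF fam j G] op_family_scaleC[OF fam j G] A_in_C[OF j G]
    by (simp add: image_subset_iff)
qed (simp_all add: op_family_mat_add[OF fam] op_family_mat_scale[OF fam])

lemma Ob_orth_iff: "x \<in> orth_diff UNIV Ob \<longleftrightarrow>
    (\<forall>(w, Gs)\<in>words n d. \<forall>u\<in>carrier_vec n. cinner (b u) (Aword A w Gs x) = 0)"
  unfolding orth_obs_iff[OF fam UNIV_I, symmetric] by (simp add: orth_diff_def)

text \<open>The outputs of \<open>A j G x\<close> are outputs of \<open>x\<close> along longer
  words, so they vanish if all outputs of \<open>x\<close> do.\<close>

lemma A_in_N:
  assumes j: "j < d" and G: "G \<in> carrier_mat n n" and x: "x \<in> N"
  shows "A j G x \<in> N"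
proof -
  have "cinner (b u) (Aword A w Gs (A j G x)) = 0" if w: "(w, Gs) \<in> words n d" and u: "u \<in> carrier_vec n" for w Gs u
  proof -
    have "(w @ [j], Gs @ [G]) \<in> words n d" by (rule words_append[OF w j G])
    then have "cinner (b u) (Aword A (w @ [j]) (Gs @ [G]) x) = 0"
      using x u unfolding Ob_orth_iff Int_iff by blast
    then show ?thesis by (simp add: Aword_append words_length[OF w])
  qed
  then show ?thesis using x j G by (auto simp: Ob_orth_iff A_in_C)
qed

lemma Q_in_M: "Q x \<in> M"
  by (rule proj_in[OF closed_M])

lemma Q_N: "z \<in> N \<Longrightarrow> Q z = 0"
  by (rule proj_eq_0[OF closed_M]) (rule M_orth_N)

text \<open>Inside \<open>C\<close> the subspaces \<open>N\<close> and \<open>M\<close> are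
  orthogonal complements. Removing the \<open>N\<close>-component of \<open>x\<close> leaves a
  vector of \<open>M\<close>, which must be \<open>Q x\<close>; the residual is the removed
  component.\<close>

lemma residual_in_N:
  assumes x: "x \<in> C"
  shows "x - Q x \<in> N"
proof -
  define y where "y = proj N x"
  have y: "y \<in> N" unfolding y_def by (rule proj_in[OF closed_N])
  have "csubspace C" using closed_C by (simp add: closed_csubspace_def)
  then have "x - y \<in> C" using x y by (intro csubspace_diff) auto
  then have "x - y \<in> M"
    unfolding minsub_def orth_diff_def[of C] using proj_orthogonal[OF closed_N, of _ x] by (simp add: y_def)
  then have "Q x = x - y"
    by (intro proj_eqI closed_M) (use y M_orth_N in auto)
  then show ?thesis using y by simp
qed

text \<open>The error \<open>x - Q x\<close> lies in \<open>N\<close>, stays there under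
  \<open>A j G\<close>, and is then annihilated by \<open>Q\<close>. So \<open>Q\<close> intertwines
  \<open>A\<close> on \<open>C\<close> with the compressed operators.\<close>

lemma Q_A:
  assumes j: "j < d" and G: "G \<in> carrier_mat n n" and x: "x \<in> C"
  shows "Q (A j G (Q x)) = Q (A j G x)"
proof -
  have "A j G x - A j G (Q x) = A j G (x - Q x)"
    by (rule op_family_diff[OF fam j G, symmetric]) simp_all
  then have "Q (A j G x) - Q (A j G (Q x)) = Q (A j G (x - Q x))"
    by (simp add: proj_diff[OF closed_M, symmetric])
  also have "\<dots> = 0" by (intro Q_N A_in_N j G residual_in_N x)
  finally show ?thesis by simp
qed

section \<open>The compressed realization and its minimality\<close>

lemma fam0: "op_family M n d A0"
  unfolding op_family_def
proof (intro conjI allI impI ballI closed_M)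
  fix j and G :: "complex mat" assume j: "j < d" and G: "G \<in> carrier_mat n n"
  obtain K where K: "\<And>x. norm (A j G x) \<le> K * norm x"
    using op_family_bounded[OF fam j G] by blast
  have "norm (Q (A j G x)) \<le> K * norm x" for x
    using norm_proj_le[OF closed_M] K by (rule order_trans)
  then show "bop M (A0 j G)"
    unfolding bop_def using op_family_add[OF fam j G] op_family_scaleC[OF fam j G]
    by (auto simp: Q_in_M proj_add[OF closed_M] proj_scaleC[OF closed_M])
qed (simp_all add: op_family_mat_add[OF fam] op_family_mat_scale[OF fam] proj_add[OF closed_M] proj_scaleC[OF closed_M])

lemma realization0: "realization M n d Y A0 (\<lambda>v. Q (b v)) (\<lambda>v. Q (c v))"
  unfolding realization_iff
  using fam0 ncpt_Y
  by (auto simp: Q_in_M b_add b_scale c_add c_scale proj_add[OF closed_M] proj_scaleC[OF closed_M])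

text \<open>Iterates \<open>Q_A\<close>; the intermediate vectors remain in \<open>C\<close>, where
  the intertwining holds.\<close>

lemma Aword0:
  assumes "(w, Gs) \<in> words n d" "x \<in> C"
  shows "Aword A0 w Gs (Q x) = Q (Aword A w Gs x)"
  using assms by (induction rule: words_induct) (auto simp: Q_A Aword_in[OF fam_C])

text \<open>The empty word shows that \<open>N\<close> is orthogonal to the values of
  \<open>b\<close>, so replacing \<open>x\<close> by \<open>Q x\<close> is invisible to
  them.\<close>

lemma cinner_b0:
  assumes u: "u \<in> carrier_vec n" and x: "x \<in> C"
  shows "cinner (Q (b u)) (Q x) = cinner (b u) x"
proof -
  have "cinner (b u) (x - Q x) = 0"
    using residual_in_N[OF x] words_Nil u unfolding Ob_orth_iff Int_iff by force
  then show ?thesis by (simp add: cinner_proj_left[OF closed_M Q_in_M] cinner_diff_right)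
qed

text \<open>\<open>Q\<close> carries the generators of \<open>C\<close> to those of the compressed
  controllable subspace, hence maps all of \<open>C\<close> into it; on \<open>M\<close>, a part of
  \<open>C\<close>, it is the identity.\<close>

lemma ctrl0: "ctrl n d A0 (\<lambda>v. Q (c v)) = M"
proof
  let ?W0 = "{Aword A0 w Gs (Q (c v)) |w Gs v. (w, Gs) \<in> words n d \<and> v \<in> carrier_vec n}"
  show "ctrl n d A0 (\<lambda>v. Q (c v)) \<subseteq> M"
    unfolding ctrl_def by (rule ccspan_minimal[OF closed_M]) (auto simp: Aword0 c_in_C Q_in_M)
  have "C \<subseteq> {x. Q x \<in> ccspan ?W0}"
    unfolding ctrl_def[of n d A c]
  proof (rule ccspan_minimal)
    show "closed_csubspace {x. Q x \<in> ccspan ?W0}"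
      by (intro closed_csubspace_vimage bop_proj closed_M closed_csubspace_ccspan)
    show "{Aword A w Gs (c v) |w Gs v. (w, Gs) \<in> words n d \<and> v \<in> carrier_vec n} \<subseteq> {x. Q x \<in> ccspan ?W0}"
    proof safe
      fix w Gs and v :: "complex Matrix.vec" assume wv: "(w, Gs) \<in> words n d" "v \<in> carrier_vec n"
      then have "Aword A0 w Gs (Q (c v)) \<in> ccspan ?W0"
        by (intro subsetD[OF ccspan_superset]) blast
      then show "Q (Aword A w Gs (c v)) \<in> ccspan ?W0" using wv by (simp only: Aword0 c_in_C)
    qed
  qed
  then show "M \<subseteq> ctrl n d A0 (\<lambda>v. Q (c v))"
    using M_subset_C proj_ident[OF closed_M] unfolding ctrl_def[of n d A0] by fastforce
qed

text \<open>A vector \<open>y\<close> of \<open>M\<close> orthogonal to the compressed observable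
  subspace has zero compressed outputs. They coincide with its original outputs, so \<open>y\<close>
  lies in \<open>N\<close> as well as in \<open>M\<close> and is zero.\<close>

lemma obs0: "obs M n d A0 (\<lambda>v. Q (b v)) = M" (is "?O = M")
proof
  show "?O \<subseteq> M"
    unfolding obs_def by (rule ccspan_minimal[OF closed_M]) (auto intro!: Adag_in[OF fam0] Q_in_M)
  then have sub: "?O \<subseteq> M" .
  have closed_O: "closed_csubspace ?O" unfolding obs_def by (rule closed_csubspace_ccspan)
  show "M \<subseteq> ?O"
  proof
    fix x assume x: "x \<in> M"
    define y where "y = x - proj ?O x"
    have pO: "proj ?O x \<in> ?O" by (rule proj_in[OF closed_O])
    have "csubspace M" using closed_M by (simp add: closed_csubspace_def)
    then have yM: "y \<in> M" unfolding y_def using x pO sub by (intro csubspace_diff) auto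
    then have yC: "y \<in> C" and Qy: "Q y = y" using M_subset_C proj_ident[OF closed_M] by auto
    have "\<forall>w\<in>?O. cinner w y = 0" unfolding y_def using proj_orthogonal[OF closed_O] by blast
    then have *: "\<And>w Gs u. (w, Gs) \<in> words n d \<Longrightarrow> u \<in> carrier_vec n \<Longrightarrow>
        cinner (Q (b u)) (Aword A0 w Gs y) = 0"
      unfolding orth_obs_iff[OF fam0 yM] by blast
    have "cinner (b u) (Aword A w Gs y) = 0" if w: "(w, Gs) \<in> words n d" and u: "u \<in> carrier_vec n" for w Gs u
      using *[OF w u] Aword0[OF w yC] cinner_b0[OF u Aword_in[OF fam_C w yC]] Qy by simp
    then have "y \<in> N" using yC unfolding Ob_orth_iff Int_iff by blast
    then have "y = 0" using Q_N Qy by simp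
    then show "x \<in> ?O" using pO by (simp add: y_def)
  qed
qed

section \<open>Comparison of the two transfer functions\<close>

lemma LA0:
  assumes v: "v \<in> tens m C"
  shows "LA n d A0 m Z (\<lambda>p. Q (v p)) = (\<lambda>p. Q (LA n d A m Z v p))"
proof
  fix p
  have "(\<Sum>j<d. \<Sum>q<m. Q (A j (blk n (Z ! j) p q) (Q (v q))))
      = (\<Sum>j<d. \<Sum>q<m. Q (A j (blk n (Z ! j) p q) (v q)))"
    using v by (intro sum.cong refl Q_A) (auto simp: tens_def blk_def)
  then show "LA n d A0 m Z (\<lambda>p. Q (v p)) p = Q (LA n d A m Z v p)"
    by (simp add: LA_def proj_diff[OF closed_M] proj_sum[OF closed_M] proj_zero[OF closed_M])
qed

lemma tf_compression:
  assumes n: "0 < n" and m: "m = dim_row (X ! 0) div n" and Z: "Z = map2 (-) X (amplt m n Y)"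
    and inj: "inj_on (LA n d A m Z) (tens m UNIV)" and inj0: "inj_on (LA n d A0 m Z) (tens m M)"
    and surj: "tens m C \<subseteq> LA n d A m Z ` tens m C"
  shows "tf UNIV n d Y A b c X = tf M n d Y A0 (\<lambda>v. Q (b v)) (\<lambda>v. Q (c v)) X"
proof -
  have "cinner (b (unit_vec n (r mod n)))
        (the_inv_into (tens m UNIV) (LA n d A m Z) (\<lambda>p. if p = s div n then c (unit_vec n (s mod n)) else 0) (r div n))
      = cinner (Q (b (unit_vec n (r mod n))))
        (the_inv_into (tens m M) (LA n d A0 m Z) (\<lambda>p. if p = s div n then Q (c (unit_vec n (s mod n))) else 0) (r div n))"
    if r: "r < m * n" and s: "s < m * n" for r s
  proof -
    \<comment> \<open>Column \<open>s\<close> of the amplified \<open>c\<close>. Its preimage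
      \<open>v\<close> inside \<open>tens m C\<close> is, by injectivity, the value chosen by
      \<open>the_inv_into\<close> on the whole space; likewise for the projected \<open>v\<close> in
      \<open>M\<close>.\<close>
    define w where "w = (\<lambda>p. if p = s div n then c (unit_vec n (s mod n)) else 0)"
    have 0: "0 \<in> C" using closed_C by (simp add: closed_csubspace_def csubspace_0)
    have lt: "s div n < m" "r div n < m" using r s by (simp_all add: less_mult_imp_div_less)
    then have "w \<in> tens m C" using 0 by (auto simp: tens_def w_def c_in_C)
    then obtain v where v: "v \<in> tens m C" "LA n d A m Z v = w" using surj by blast
    have vC: "v (r div n) \<in> C" using v lt by (simp add: tens_def)
    have "v \<in> tens m UNIV" using v by (simp add: tens_def)
    then have 1: "the_inv_into (tens m UNIV) (LA n d A m Z) w = v"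
      using the_inv_into_f_f[OF inj] v(2) by blast
    have "(\<lambda>p. Q (v p)) \<in> tens m M" using v by (auto simp: tens_def Q_in_M proj_zero[OF closed_M])
    moreover have "LA n d A0 m Z (\<lambda>p. Q (v p)) = (\<lambda>p. if p = s div n then Q (c (unit_vec n (s mod n))) else 0)"
      unfolding LA0[OF v(1)] v(2) by (auto simp: w_def proj_zero[OF closed_M])
    ultimately have 2: "the_inv_into (tens m M) (LA n d A0 m Z)
        (\<lambda>p. if p = s div n then Q (c (unit_vec n (s mod n))) else 0) = (\<lambda>p. Q (v p))"
      using the_inv_into_f_f[OF inj0] by metis
    show ?thesis unfolding w_def[symmetric] 1 2 by (simp add: cinner_b0 vC)
  qed
  then show ?thesis
    unfolding tf_def using n by (auto simp: Let_def m[symmetric] Z[symmetric] intro!: eq_matI)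
qed

lemma inv_op_inj: "inv_op m S L \<Longrightarrow> inj_on L (tens m S)"
  unfolding inv_op_def by (metis inj_on_inverseI)

text \<open>For \<open>d = 0\<close> the block size that \<open>tf\<close> reads off from \<open>X ! 0\<close> is arbitrary, but then
  \<open>L_A\<close> is the identity.\<close>

lemma tf_eq:
  assumes X: "X \<in> Dm UNIV n d Y A m" and X0: "X \<in> Dm M n d Y A0 m0"
    and surj: "tens m C \<subseteq> LA n d A m (map2 (-) X (amplt m n Y)) ` tens m C"
  shows "tf UNIV n d Y A b c X = tf M n d Y A0 (\<lambda>v. Q (b v)) (\<lambda>v. Q (c v)) X"
proof (cases "n = 0")
  case True
  then show ?thesis unfolding tf_def by (auto simp: Let_def intro!: eq_matI)
next
  case n: False
  define k where "k = dim_row (X ! 0) div n"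
  define Z where "Z = map2 (-) X (amplt k n Y)"
  have "inj_on (LA n d A k Z) (tens k UNIV) \<and> inj_on (LA n d A0 k Z) (tens k M) \<and>
      tens k C \<subseteq> LA n d A k Z ` tens k C"
  proof (cases "d = 0")
    case True
    have 1: "LA n d A k Z v = v" if "v \<in> tens k UNIV" for v
      by (rule LA_zero[OF fam _ that]) (simp add: True)
    have 2: "LA n d A0 k Z v = v" if "v \<in> tens k M" for v
      by (rule LA_zero[OF fam0 _ that]) (simp add: True)
    have "v \<in> LA n d A k Z ` tens k C" if "v \<in> tens k C" for v
      using that 1[of v] by (intro image_eqI[of _ _ v]) (auto simp: tens_def)
    then show ?thesis using 1 2 by (auto simp: inj_on_def)
  next
    case False
    then have "X ! 0 \<in> carrier_mat (m * n) (m * n)" "X ! 0 \<in> carrier_mat (m0 * n) (m0 * n)"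
      using X X0 by (auto simp: Dm_def ncpt_def)
    \<comment> \<open>The two domains might hold \<open>X\<close> at different levels; for nonzero
      \<open>n\<close> its first matrix forces both to equal the level that \<open>tf\<close> reads
      off.\<close>
    then have km: "k = m" "k = m0" using n by (auto simp: k_def)
    have "inv_op k UNIV (LA n d A k Z)" using X km(1) by (simp add: Dm_def Z_def)
    moreover have "inv_op k M (LA n d A0 k Z)" using X0 km(2) by (simp add: Dm_def Z_def)
    ultimately show ?thesis using surj km(1) by (auto simp: Z_def intro: inv_op_inj)
  qed
  then show ?thesis using n by (intro tf_compression[OF _ k_def Z_def]) auto
qed

text \<open>The path for \<open>A\<close> yields surjectivity on \<open>tens m C\<close>; membership
  in the other component yields invertibility of the compressed pencil at the endpoint.\<close>

lemma Dpath_tf_eq: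
  assumes X: "X \<in> Dpath UNIV n d Y A" and X0: "X \<in> Dpath M n d Y A0"
  shows "tf UNIV n d Y A b c X = tf M n d Y A0 (\<lambda>v. Q (b v)) (\<lambda>v. Q (c v)) X"
proof -
  obtain m \<gamma> where \<gamma>: "\<And>t. t \<in> {0..1::real} \<Longrightarrow> \<gamma> t \<in> Dm UNIV n d Y A m"
    and cont: "\<And>j i l. j < d \<Longrightarrow> i < m * n \<Longrightarrow> l < m * n \<Longrightarrow> continuous_on {0..1} (\<lambda>t. (\<gamma> t ! j) $$ (i, l))"
    and ends: "\<gamma> 0 = amplt m n Y" "\<gamma> 1 = X"
    using X unfolding Dpath_def by blast
  obtain m0 \<gamma>0 where \<gamma>0: "\<And>t. t \<in> {0..1::real} \<Longrightarrow> \<gamma>0 t \<in> Dm M n d Y A0 m0" "\<gamma>0 1 = X"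
    using X0 unfolding Dpath_def by blast
  have "X \<in> Dm UNIV n d Y A m" using \<gamma>[of 1] ends by simp
  moreover have "X \<in> Dm M n d Y A0 m0" using \<gamma>0(1)[of 1] \<gamma>0(2) by simp
  moreover have "tens m C \<subseteq> LA n d A m (map2 (-) X (amplt m n Y)) ` tens m C"
    using path_component_preserves_invariant_subspace[OF fam fam_C ncpt_Y \<gamma> cont ends(1)] ends(2) by simp
  ultimately show ?thesis by (rule tf_eq)
qed

text \<open>Three radii are intersected: on the whole space and on \<open>M\<close> they put the
  ball into the two domains, on \<open>C\<close> they give the surjectivity that
  \<open>tf_eq\<close> requires.\<close>

lemma an_equiv0: "an_equiv UNIV M n d Y A b c A0 (\<lambda>v. Q (b v)) (\<lambda>v. Q (c v))"
proof -
  obtain r1 where r1: "0 < r1" "\<And>m X. ncpt d (m * n) X \<Longrightarrow> colnorm (m * n) (map2 (-) X (amplt m n Y)) < r1 \<Longrightarrow>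
      inv_op m UNIV (LA n d A m (map2 (-) X (amplt m n Y)))"
    by (rule LA_invertible_near_center[OF fam ncpt_Y]) (rule that)
  obtain r2 where r2: "0 < r2" "\<And>m X. ncpt d (m * n) X \<Longrightarrow> colnorm (m * n) (map2 (-) X (amplt m n Y)) < r2 \<Longrightarrow>
      inv_op m C (LA n d A m (map2 (-) X (amplt m n Y)))"
    by (rule LA_invertible_near_center[OF fam_C ncpt_Y]) (rule that)
  obtain r3 where r3: "0 < r3" "\<And>m X. ncpt d (m * n) X \<Longrightarrow> colnorm (m * n) (map2 (-) X (amplt m n Y)) < r3 \<Longrightarrow>
      inv_op m M (LA n d A0 m (map2 (-) X (amplt m n Y)))"
    by (rule LA_invertible_near_center[OF fam0 ncpt_Y]) (rule that)
  define r where "r = min r1 (min r2 r3)"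
  have r: "0 < r" using r1 r2 r3 by (simp add: r_def)
  define U where "U = uball d n Y r"
  have in_U: "\<exists>m\<ge>1. X \<in> Dm UNIV n d Y A m \<and> X \<in> Dm M n d Y A0 m \<and>
      tens m C \<subseteq> LA n d A m (map2 (-) X (amplt m n Y)) ` tens m C" if "X \<in> U" for X
  proof -
    obtain m where m: "m \<ge> 1" and X: "ncpt d (m * n) X"
      and small: "colnorm (m * n) (map2 (-) X (amplt m n Y)) < r"
      using \<open>X \<in> U\<close> unfolding U_def uball_def by blast
    have "inv_op m C (LA n d A m (map2 (-) X (amplt m n Y)))"
      by (rule r2(2)[OF X]) (use small in \<open>simp add: r_def\<close>)
    then have "tens m C \<subseteq> LA n d A m (map2 (-) X (amplt m n Y)) ` tens m C"
      unfolding inv_op_def by (metis image_eqI subsetI)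
    moreover have "X \<in> Dm UNIV n d Y A m" "X \<in> Dm M n d Y A0 m"
      unfolding Dm_def using X small r1(2)[OF X] r3(2)[OF X] by (simp_all add: r_def)
    ultimately show ?thesis using m by blast
  qed
  have "uniformly_open d U"
    unfolding uniformly_open_def U_def by (rule generate_topology.Basis) (use ncpt_Y r in blast)
  moreover have "Y \<in> U"
    unfolding U_def uball_def using colnorm_diff_self[OF ncpt_Y] ncpt_Y r by (intro CollectI exI[of _ 1]) simp
  moreover have "U \<subseteq> DY UNIV n d Y A \<inter> DY M n d Y A0"
    using in_U unfolding DY_def by fastforce
  moreover have "\<forall>X\<in>U. tf UNIV n d Y A b c X = tf M n d Y A0 (\<lambda>v. Q (b v)) (\<lambda>v. Q (c v)) X"
    using in_U tf_eq by blast
  ultimately show ?thesis unfolding an_equiv_def by blast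
qed

end

theorem mainTheorem3:
  fixes A :: "nat \<Rightarrow> complex mat \<Rightarrow> 'h::chilbert_space \<Rightarrow> 'h"
    and b c :: "complex vec \<Rightarrow> 'h" and Y :: "complex mat list" and n d :: nat
  assumes "realization UNIV n d Y A b c"
  shows "let M = minsub UNIV n d A b c;
             A0 = (\<lambda>j G x. proj M (A j G x));
             b0 = (\<lambda>v. proj M (b v));
             c0 = (\<lambda>v. proj M (c v))
         in realization M n d Y A0 b0 c0 \<and> minimal M n d A0 b0 c0 \<and>
            an_equiv UNIV M n d Y A b c A0 b0 c0 \<and>
            (\<forall>X \<in> Dpath UNIV n d Y A \<inter> Dpath M n d Y A0.
               tf UNIV n d Y A b c X = tf M n d Y A0 b0 c0 X)"
proof -
  interpret hilbert_realization A b c Y n d by unfold_locales (rule assms)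
  show ?thesis
    unfolding Let_def minimal_def
    using realization0 ctrl0 obs0 an_equiv0 Dpath_tf_eq by blast
qed

end
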